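(* For $\tau\in\mathbb{H}$ write $\beta_i=\dfrac{\vartheta_2^2(i\pi/12,\tau)}{\vartheta_3^2(i\pi/12,\tau)}$ for $i=1,3,5$. The following identities of meromorphic functions of $\tau\in\mathbb{H}$ hold: $$\beta_1+\beta_3+\beta_5=\frac{6\vartheta_2(0,6\tau)\left(\vartheta_2^2(0,6\tau)+\vartheta_3^2(0,6\tau)\right)}{\vartheta_2^2(0,\tau)\vartheta_3^2(0,\tau)}\cdot\frac{3\vartheta_2^2(0,\tau)\vartheta_3^2(0,\tau)\vartheta_2(0,6\tau)-\vartheta_3(0,6\tau)\left[\vartheta_2^4(0,\tau)+\vartheta_3^4(0,\tau)+45\vartheta_2^4(0,6\tau)-9\vartheta_3^4(0,6\tau)\right]}{\vartheta_2^2(0,\tau)\vartheta_3^2(0,\tau)-18\vartheta_2(0,6\tau)\vartheta_3(0,6\tau)\left(\vartheta_2^2(0,6\tau)+\vartheta_3^2(0,6\tau)\right)},$$ $$\beta_1\beta_3+\beta_1\beta_5+\beta_3\beta_5=\frac{6\vartheta_2(0,6\tau)\left(\vartheta_2^2(0,6\tau)+\vartheta_3^2(0,6\tau)\right)}{\vartheta_2^2(0,\tau)\vartheta_3^2(0,\tau)}\cdot\frac{3\vartheta_2^2(0,\tau)\vartheta_3^2(0,\tau)\vartheta_3(0,6\tau)-\vartheta_2(0,6\tau)\left[\vartheta_2^4(0,\tau)+\vartheta_3^4(0,\tau)-9\vartheta_2^4(0,6\tau)+45\vartheta_3^4(0,6\tau)\right]}{\vartheta_2^2(0,\tau)\vartheta_3^2(0,\tau)-18\vartheta_2(0,6\tau)\vartheta_3(0,6\tau)\left(\vartheta_2^2(0,6\tau)+\vartheta_3^2(0,6\tau)\right)},$$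 and $$\beta_1\beta_3\beta_5=\frac{\vartheta_2(0,6\tau)}{\vartheta_3(0,6\tau)}.$$
   Context: $\mathbb{H}$ is the open upper half plane. For $\tau\in\mathbb{H}$, with $q=e^{2\pi i\tau}$ and $q^s=e^{2\pi i s\tau}$ (here $i$ in the exponents is the imaginary unit), $$\vartheta_2(v,\tau)=\sum_{m=-\infty}^\infty q^{(m+1/2)^2}e^{(2m+1)iv},\qquad \vartheta_3(v,\tau)=\sum_{m=-\infty}^\infty q^{m^2}e^{2miv}.$$ In the definition of $\beta_i$, the letter $i$ is the index $1,3,5$. *)

theory Defs
  imports "HOL-Complex_Analysis.Complex_Analysis"
begin

definition upper_half_plane :: "complex set" where
  "upper_half_plane = {\<tau>. Im \<tau> > 0}"

(* qpow \<tau> s is q^s with q = exp (2 pi i \<tau>).  It is defined through \<tau>, not as a power of the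
   complex number q, so that no branch of the logarithm enters for fractional s.
   Note that the nome is exp (2 pi i \<tau>), not exp (pi i \<tau>). *)
definition qpow :: "complex \<Rightarrow> complex \<Rightarrow> complex" where
  "qpow \<tau> s = exp (2 * complex_of_real pi * \<i> * s * \<tau>)"

definition theta2 :: "complex \<Rightarrow> complex \<Rightarrow> complex" where
  "theta2 v \<tau> =
     (\<Sum>\<^sub>\<infinity>m::int. qpow \<tau> ((of_int m + 1/2)^2) * exp (of_int (2 * m + 1) * \<i> * v))"

definition theta3 :: "complex \<Rightarrow> complex \<Rightarrow> complex" where
  "theta3 v \<tau> =
     (\<Sum>\<^sub>\<infinity>m::int. qpow \<tau> (of_int m ^ 2) * exp (2 * of_int m * \<i> * v))"

(* The index k is an integer, not the imaginary unit: the first argument k * pi / 12 is real. *)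
definition beta :: "nat \<Rightarrow> complex \<Rightarrow> complex" where
  "beta k \<tau> = theta2 (of_nat k * complex_of_real pi / 12) \<tau> ^ 2
              / theta3 (of_nat k * complex_of_real pi / 12) \<tau> ^ 2"

(* Equality of meromorphic functions on A.  Values at a sparse set of points are disregarded,
   since there a quotient may be 0 by the convention x / 0 = 0.  By continuity, f and g then
   agree at every point of an open A at which both are analytic. *)
definition meromorphic_identity_on ::
    "complex set \<Rightarrow> (complex \<Rightarrow> complex) \<Rightarrow> (complex \<Rightarrow> complex) \<Rightarrow> bool" where
  "meromorphic_identity_on A f g \<longleftrightarrow>
     f meromorphic_on A \<and> g meromorphic_on A \<and> eventually (\<lambda>z. f z = g z) (cosparse A)"

end

theory Submission
  imports Defs
begin

text \<open>
  Let u(\<tau>) and r(\<tau>) be the values of \<theta>2/\<theta>3 at v = 0 and at the point v = \<pi>/3 of order three.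
  The proof expresses all quantities of the theorem through u and r at 2\<tau> and then computes on an algebraic curve.

  The basic input is the pair of addition formulas \<open>theta3_addition\<close> and \<open>theta2_addition\<close>, which
  express \<theta>(x+y,\<tau>) \<theta>(x-y,\<tau>) through theta values at 2\<tau> and come from the substitution
  (k, l) \<mapsto> (k + l, k - l) in a double series.  They relate u and r at \<tau> to u and r at 2\<tau>, and elimination gives
  the curve u (1 - r^4) = 2 r (1 - u^2 r^2) (\<open>eventually_curve\<close>).  They also give
  \<beta>_3 = u, \<beta>_1 \<beta>_5 = r^2 and \<beta>_1 + \<beta>_5 = 2 u (1 + r^2) / (1 + u^2),
  with u and r at 2\<tau> (\<open>eventually_beta\<close>).

  The passage from 2\<tau> to 6\<tau> rests on two facts: u(3\<tau>) = u r^2 (\<open>eventually_u_triple\<close>) and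
  \<theta>3(0,\<tau>)^2 = \<theta>3(0,3\<tau>)^2 (1 + 2 u r^3) (\<open>eventually_multiplier\<close>).  Instead of
  infinite products or the theory of modular forms, a descent is used: both sides of each equation satisfy the same
  functional equation under \<tau> \<mapsto> 2\<tau> and have the same leading term as Im \<tau> tends to infinity, and this forces
  equality (\<open>eventually_zero_by_doubling\<close>).

  Both sides of the three identities are now functions on the curve.  The third identity is immediate; the first two
  become polynomial identities modulo the equation of the curve, proved by means of the parameter p = u r^3
  (\<open>curve_sum_identity\<close>, \<open>curve_pair_sum_identity\<close>).  All of this takes place for large Im \<tau>, where
  leading terms show that the denominators do not vanish; the identity theorem for meromorphic functions extends the
  result to the upper half plane (\<open>meromorphic_identity_from_cusp\<close>).
\<close>

section \<open>The theta series as sums over a parity class\<close>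

text \<open>
  The general term of both theta series.  Indexing by n = 2m for \<theta>3 and n = 2m + 1 for \<theta>2
  turns both into sums of the same function over the even and the odd integers, which is what makes the
  change of variables behind the addition formulas transparent.
\<close>

definition theta_term :: "real \<Rightarrow> complex \<Rightarrow> int \<Rightarrow> complex" where
  "theta_term x \<tau> n = exp (\<i> * (of_real pi * \<tau> * of_int (n ^ 2) / 2 + of_int n * of_real x))"

lemma theta2_eq_odd_sum: "theta2 (of_real x) \<tau> = (\<Sum>\<^sub>\<infinity>n | odd n. theta_term x \<tau> n)"
proof -
  have "bij_betw (\<lambda>m::int. 2 * m + 1) UNIV {n. odd n}"
    by (rule bij_betwI[where g = "\<lambda>n. n div 2"]) auto
  then have "(\<Sum>\<^sub>\<infinity>n | odd n. theta_term x \<tau> n) = (\<Sum>\<^sub>\<infinity>m. theta_term x \<tau> (2 * m + 1))"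
    by (rule infsum_reindex_bij_betw[symmetric])
  also have "\<dots> = theta2 (of_real x) \<tau>"
    unfolding theta2_def theta_term_def qpow_def exp_add[symmetric]
    by (intro infsum_cong arg_cong[where f = exp])
       (simp add: field_simps power2_eq_square)
  finally show ?thesis ..
qed

lemma theta3_eq_even_sum: "theta3 (of_real x) \<tau> = (\<Sum>\<^sub>\<infinity>n | even n. theta_term x \<tau> n)"
proof -
  have "bij_betw (\<lambda>m::int. 2 * m) UNIV {n. even n}"
    by (rule bij_betwI[where g = "\<lambda>n. n div 2"]) auto
  then have "(\<Sum>\<^sub>\<infinity>n | even n. theta_term x \<tau> n) = (\<Sum>\<^sub>\<infinity>m. theta_term x \<tau> (2 * m))"
    by (rule infsum_reindex_bij_betw[symmetric])
  also have "\<dots> = theta3 (of_real x) \<tau>"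
    unfolding theta3_def theta_term_def qpow_def exp_add[symmetric]
    by (intro infsum_cong arg_cong[where f = exp])
       (simp add: field_simps power2_eq_square)
  finally show ?thesis ..
qed

lemma summable_on_power_abs_int:
  fixes \<rho> :: real
  assumes "0 \<le> \<rho>" "\<rho> < 1"
  shows "(\<lambda>n::int. \<rho> ^ nat \<bar>n\<bar>) summable_on UNIV"
proof -
  have geom: "(\<lambda>k::nat. \<rho> ^ k) summable_on UNIV"
    using assms by (intro summable_on_UNIV_nonneg_real_iff[THEN iffD2]) (auto intro: summable_geometric)
  have "(\<lambda>n::int. \<rho> ^ nat \<bar>n\<bar>) summable_on {0..}"
    using summable_on_reindex_bij_witness[of "UNIV :: nat set" nat int "{0..}"
        "\<lambda>n::int. \<rho> ^ nat \<bar>n\<bar>" "\<lambda>k. \<rho> ^ k"] geom by auto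
  moreover have "(\<lambda>n::int. \<rho> ^ nat \<bar>n\<bar>) summable_on {..<0}"
  proof -
    have "(\<lambda>k::nat. \<rho> ^ k) summable_on {1..}"
      by (rule summable_on_subset_banach[OF geom]) auto
    then show ?thesis
      using summable_on_reindex_bij_witness[of "{1::nat..}" "\<lambda>n. nat (- n)" "\<lambda>k. - int k" "{..<0}"
        "\<lambda>n::int. \<rho> ^ nat \<bar>n\<bar>" "\<lambda>k. \<rho> ^ k"] by auto
  qed
  ultimately have "(\<lambda>n::int. \<rho> ^ nat \<bar>n\<bar>) summable_on ({0..} \<union> {..<0})"
    by (intro summable_on_Un_disjoint) auto
  also have "{0..} \<union> {..<0} = (UNIV :: int set)" by auto
  finally show ?thesis .
qed

lemma norm_theta_term: "norm (theta_term x \<tau> n) = exp (- (pi * Im \<tau> * of_int (n ^ 2) / 2))"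
  by (simp add: theta_term_def)

lemma abs_le_square_int: "\<bar>n\<bar> \<le> (n::int) ^ 2"
proof (cases "n = 0")
  case False
  then have "\<bar>n\<bar> * 1 \<le> \<bar>n\<bar> * \<bar>n\<bar>" by (intro mult_left_mono) auto
  then show ?thesis by (simp add: power2_eq_square)
qed simp

lemma norm_theta_term_le:
  assumes "0 \<le> \<delta>" "\<delta> \<le> Im \<tau>"
  shows "norm (theta_term x \<tau> n) \<le> exp (- (pi * \<delta> / 2)) ^ nat \<bar>n\<bar>"
proof -
  have "real_of_int \<bar>n\<bar> \<le> of_int (n ^ 2)"
    using abs_le_square_int[of n] of_int_le_iff by blast
  then have "\<delta> * real_of_int \<bar>n\<bar> \<le> Im \<tau> * of_int (n ^ 2)"
    using assms by (intro mult_mono) auto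
  then have "pi * (\<delta> * real_of_int \<bar>n\<bar>) \<le> pi * (Im \<tau> * of_int (n ^ 2))"
    by simp
  then show ?thesis
    by (simp add: norm_theta_term exp_of_nat_mult[symmetric] mult_ac)
qed

lemma theta_term_abs_summable:
  assumes "Im \<tau> > 0"
  shows "(\<lambda>n. norm (theta_term x \<tau> n)) summable_on A"
proof -
  have "(\<lambda>n::int. exp (- (pi * Im \<tau> / 2)) ^ nat \<bar>n\<bar>) summable_on UNIV"
    by (rule summable_on_power_abs_int) (simp_all add: assms)
  then have "(\<lambda>n. norm (theta_term x \<tau> n)) summable_on UNIV"
    by (rule Infinite_Sum.abs_summable_on_comparison_test'[where f = "theta_term x \<tau>"]) (use assms in \<open>auto intro: norm_theta_term_le\<close>)
  then show ?thesis
    by (rule summable_on_subset_banach) auto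
qed

section \<open>Addition formulas\<close>

lemma infsum_product_Times:
  fixes f :: "'a \<Rightarrow> complex" and g :: "'b \<Rightarrow> complex"
  assumes f: "(\<lambda>x. norm (f x)) summable_on A" and g: "(\<lambda>y. norm (g y)) summable_on B"
  shows "(\<lambda>(x, y). f x * g y) summable_on A \<times> B"
    and "infsum f A * infsum g B = (\<Sum>\<^sub>\<infinity>(x, y)\<in>A \<times> B. f x * g y)"
proof -
  have "(\<lambda>(x, y). norm (f x) * norm (g y)) summable_on A \<times> B"
  proof (rule summable_on_SigmaI)
    show "((\<lambda>y. case (x, y) of (x, y) \<Rightarrow> norm (f x) * norm (g y)) has_sum
        norm (f x) * infsum (\<lambda>y. norm (g y)) B) B" for x
      unfolding prod.case by (intro has_sum_cmult_right has_sum_infsum g)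
    show "(\<lambda>x. norm (f x) * infsum (\<lambda>y. norm (g y)) B) summable_on A"
      using f by (rule summable_on_cmult_left)
  qed simp
  then have "(\<lambda>z. norm (case z of (x, y) \<Rightarrow> f x * g y)) summable_on A \<times> B"
    by (simp add: case_prod_unfold norm_mult)
  then show summ: "(\<lambda>(x, y). f x * g y) summable_on A \<times> B"
    by (rule abs_summable_summable)
  have gs: "g summable_on B"
    using g by (rule abs_summable_summable)
  have "(\<Sum>\<^sub>\<infinity>(x, y)\<in>A \<times> B. f x * g y) = (\<Sum>\<^sub>\<infinity>x\<in>A. \<Sum>\<^sub>\<infinity>y\<in>B. f x * g y)"
    using infsum_Sigma'_banach[OF summ] by simp
  also have "\<dots> = infsum f A * infsum g B"
    by (simp only: infsum_cmult_right[OF gs] infsum_cmult_left[OF abs_summable_summable[OF f]])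
  finally show "infsum f A * infsum g B = (\<Sum>\<^sub>\<infinity>(x, y)\<in>A \<times> B. f x * g y)" ..
qed

text \<open>
  The two quadratic forms match since (k + l)^2 + (k - l)^2 = 2k^2 + 2l^2.
\<close>

lemma theta_term_rotate:
  "theta_term (x + y) \<tau> (k + l) * theta_term (x - y) \<tau> (k - l) =
     theta_term (2 * x) (2 * \<tau>) k * theta_term (2 * y) (2 * \<tau>) l"
proof -
  have *: "\<i> * (p * t * (k + l)\<^sup>2 / 2 + (k + l) * (x + y)) + \<i> * (p * t * (k - l)\<^sup>2 / 2 + (k - l) * (x - y))
      = \<i> * (p * (2 * t) * k\<^sup>2 / 2 + k * (2 * x)) + \<i> * (p * (2 * t) * l\<^sup>2 / 2 + l * (2 * y))"
    for p t k l x y :: complex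
    by (simp add: power2_eq_square algebra_simps add_divide_distrib diff_divide_distrib)
  show ?thesis
    unfolding theta_term_def exp_add[symmetric]
    by (intro arg_cong[where f = exp]) (simp only: of_int_add of_int_diff of_int_power of_real_add of_real_diff of_real_mult of_real_numeral *)
qed

text \<open>
  The map (k, l) \<mapsto> (k + l, k - l) is a bijection from all pairs of integers onto the pairs of equal parity;
  restricting the parity of the image selects a union of parity classes of (k, l).
\<close>

lemma theta_term_sum_rotate:
  assumes "Im \<tau> > 0" and P: "P = {n. even n} \<or> P = {n. odd n}"
  shows "(\<Sum>\<^sub>\<infinity>m\<in>P. theta_term (x + y) \<tau> m) * (\<Sum>\<^sub>\<infinity>n\<in>P. theta_term (x - y) \<tau> n) =
    (\<Sum>\<^sub>\<infinity>(k, l) | k + l \<in> P \<and> k - l \<in> P. theta_term (2 * x) (2 * \<tau>) k * theta_term (2 * y) (2 * \<tau>) l)"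
proof -
  have bij: "bij_betw (\<lambda>(k, l). (k + l, k - l)) {(k, l). k + l \<in> P \<and> k - l \<in> P} (P \<times> P)"
  proof (rule bij_betwI[where g = "\<lambda>(m, n). ((m + n) div 2, (m - n) div 2)"])
    have halves: "(m + n) div 2 + (m - n) div 2 = m" "(m + n) div 2 - (m - n) div 2 = n"
      if "m \<in> P" "n \<in> P" for m n
    proof -
      have "even (m + n)" using P that by auto
      then show "(m + n) div 2 + (m - n) div 2 = m" "(m + n) div 2 - (m - n) div 2 = n"
        by presburger+
    qed
    show "(\<lambda>(m, n). ((m + n) div 2, (m - n) div 2)) \<in> P \<times> P \<rightarrow> {(k, l). k + l \<in> P \<and> k - l \<in> P}"
      by (simp add: Pi_iff halves)
    show "(\<lambda>(k, l). (k + l, k - l)) ((\<lambda>(m, n). ((m + n) div 2, (m - n) div 2)) z) = z"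
      if "z \<in> P \<times> P" for z
      using that by (cases z) (simp add: halves)
  qed auto
  have "(\<Sum>\<^sub>\<infinity>m\<in>P. theta_term (x + y) \<tau> m) * (\<Sum>\<^sub>\<infinity>n\<in>P. theta_term (x - y) \<tau> n) =
      (\<Sum>\<^sub>\<infinity>(m, n)\<in>P \<times> P. theta_term (x + y) \<tau> m * theta_term (x - y) \<tau> n)"
    by (intro infsum_product_Times theta_term_abs_summable assms)
  also have "\<dots> = (\<Sum>\<^sub>\<infinity>(k, l) | k + l \<in> P \<and> k - l \<in> P.
      theta_term (2 * x) (2 * \<tau>) k * theta_term (2 * y) (2 * \<tau>) l)"
    by (subst infsum_reindex_bij_betw[OF bij, symmetric])
       (auto intro!: infsum_cong simp: theta_term_rotate)
  finally show ?thesis .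
qed

lemma theta3_addition:
  assumes "Im \<tau> > 0"
  shows "theta3 (of_real (x + y)) \<tau> * theta3 (of_real (x - y)) \<tau> =
     theta3 (of_real (2 * x)) (2 * \<tau>) * theta3 (of_real (2 * y)) (2 * \<tau>) +
     theta2 (of_real (2 * x)) (2 * \<tau>) * theta2 (of_real (2 * y)) (2 * \<tau>)"
proof -
  have eq: "{(k::int, l). even (k + l) \<and> even (k - l)} =
      {n. even n} \<times> {n. even n} \<union> {n. odd n} \<times> {n. odd n}"
    by (simp add: set_eq_iff split_paired_all) blast
  have "Im (2 * \<tau>) > 0" using assms by simp
  note * = infsum_product_Times[OF theta_term_abs_summable[OF this] theta_term_abs_summable[OF this]]
  show ?thesis
    unfolding theta2_eq_odd_sum theta3_eq_even_sum
      theta_term_sum_rotate[OF assms disjI1[OF refl]] * mem_Collect_eq eq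
    by (rule infsum_Un_disjoint) (auto intro: *(1))
qed

lemma theta2_addition:
  assumes "Im \<tau> > 0"
  shows "theta2 (of_real (x + y)) \<tau> * theta2 (of_real (x - y)) \<tau> =
     theta2 (of_real (2 * x)) (2 * \<tau>) * theta3 (of_real (2 * y)) (2 * \<tau>) +
     theta3 (of_real (2 * x)) (2 * \<tau>) * theta2 (of_real (2 * y)) (2 * \<tau>)"
proof -
  have eq: "{(k::int, l). odd (k + l) \<and> odd (k - l)} =
      {n. odd n} \<times> {n. even n} \<union> {n. even n} \<times> {n. odd n}"
    by (simp add: set_eq_iff split_paired_all) blast
  have "Im (2 * \<tau>) > 0" using assms by simp
  note * = infsum_product_Times[OF theta_term_abs_summable[OF this] theta_term_abs_summable[OF this]]
  show ?thesis
    unfolding theta2_eq_odd_sum theta3_eq_even_sum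
      theta_term_sum_rotate[OF assms disjI2[OF refl]] * mem_Collect_eq eq
    by (rule infsum_Un_disjoint) (auto intro: *(1))
qed

lemma theta_term_pi_minus: "theta_term (pi - x) \<tau> n = (if even n then 1 else - 1) * theta_term x \<tau> (- n)"
proof -
  have e: "theta_term (pi - x) \<tau> n = exp (\<i> * of_real (of_int n * pi)) * theta_term x \<tau> (- n)"
    unfolding theta_term_def exp_add[symmetric]
    by (intro arg_cong[where f = exp]) (simp add: algebra_simps)
  have "exp (\<i> * of_real (of_int n * pi)) = cis (pi * of_int n)"
    by (simp add: cis_conv_exp mult_ac)
  also have "\<dots> = (if even n then 1 else - 1)"
    by (auto simp: complex_eq_iff sin_zero_iff_int2 cos_npi_int)
  finally show ?thesis using e by simp
qed

lemma theta3_pi_minus: "theta3 (of_real (pi - x)) \<tau> = theta3 (of_real x) \<tau>"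
  unfolding theta3_eq_even_sum
  by (rule infsum_reindex_bij_witness[of _ uminus uminus]) (auto simp: theta_term_pi_minus)

lemma theta2_pi_minus: "theta2 (of_real (pi - x)) \<tau> = - theta2 (of_real x) \<tau>"
proof -
  have "theta2 (of_real (pi - x)) \<tau> = (\<Sum>\<^sub>\<infinity>n | odd n. - theta_term x \<tau> n)"
    unfolding theta2_eq_odd_sum
    by (rule infsum_reindex_bij_witness[of _ uminus uminus]) (auto simp: theta_term_pi_minus)
  then show ?thesis by (simp add: theta2_eq_odd_sum infsum_uminus)
qed

section \<open>Holomorphy\<close>

lemma uniform_limit_theta_term_sum:
  assumes "\<delta> > 0"
  shows "uniform_limit {\<tau>. \<delta> \<le> Im \<tau>} (\<lambda>X \<tau>. \<Sum>n\<in>X. theta_term x \<tau> n)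
    (\<lambda>\<tau>. \<Sum>\<^sub>\<infinity>n\<in>A. theta_term x \<tau> n) (finite_subsets_at_top A)"
proof (rule Weierstrass_m_test_general)
  have "(\<lambda>n::int. exp (- (pi * \<delta> / 2)) ^ nat \<bar>n\<bar>) summable_on UNIV"
    by (rule summable_on_power_abs_int) (simp_all add: assms)
  then show "(\<lambda>n::int. exp (- (pi * \<delta> / 2)) ^ nat \<bar>n\<bar>) summable_on A"
    by (rule summable_on_subset_banach) auto
qed (use assms in \<open>auto intro: norm_theta_term_le\<close>)

lemma holomorphic_theta_term_sum:
  "(\<lambda>\<tau>. \<Sum>\<^sub>\<infinity>n\<in>A. theta_term x \<tau> n) holomorphic_on {\<tau>. Im \<tau> > 0}"
proof -
  have "\<exists>r>0. (\<lambda>\<tau>. \<Sum>\<^sub>\<infinity>n\<in>A. theta_term x \<tau> n) holomorphic_on ball z r" if "Im z > 0" for z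
  proof (intro exI conjI)
    \<comment> \<open>this radius keeps the closed ball in a half plane of uniform convergence\<close>
    let ?r = "Im z / 2"
    show "?r > 0" using that by simp
    have sub: "cball z ?r \<subseteq> {\<tau>. Im z / 2 \<le> Im \<tau>}"
    proof
      fix w assume "w \<in> cball z ?r"
      then have "\<bar>Im (z - w)\<bar> \<le> Im z / 2"
        using abs_Im_le_cmod[of "z - w"] by (auto simp: dist_norm)
      then have "Im (z - w) \<le> Im z / 2"
        by (rule order_trans[OF abs_ge_self])
      then show "w \<in> {\<tau>. Im z / 2 \<le> Im \<tau>}"
        by simp
    qed
    have hol: "(\<lambda>\<tau>. \<Sum>n\<in>X. theta_term x \<tau> n) holomorphic_on B" for X B
      unfolding theta_term_def by (intro holomorphic_intros) auto
    show "(\<lambda>\<tau>. \<Sum>\<^sub>\<infinity>n\<in>A. theta_term x \<tau> n) holomorphic_on ball z ?r"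
    proof (rule holomorphic_uniform_limit[of z ?r "\<lambda>X \<tau>. \<Sum>n\<in>X. theta_term x \<tau> n" "finite_subsets_at_top A"])
      show "\<forall>\<^sub>F X in finite_subsets_at_top A. continuous_on (cball z ?r) (\<lambda>\<tau>. \<Sum>n\<in>X. theta_term x \<tau> n) \<and>
          (\<lambda>\<tau>. \<Sum>n\<in>X. theta_term x \<tau> n) holomorphic_on ball z ?r"
        by (intro always_eventually allI conjI hol holomorphic_on_imp_continuous_on)
      show "uniform_limit (cball z ?r) (\<lambda>X \<tau>. \<Sum>n\<in>X. theta_term x \<tau> n)
          (\<lambda>\<tau>. \<Sum>\<^sub>\<infinity>n\<in>A. theta_term x \<tau> n) (finite_subsets_at_top A)"
        by (rule uniform_limit_on_subset[OF uniform_limit_theta_term_sum sub]) (use that in simp)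
    qed simp_all
  qed
  then show ?thesis
    using holomorphic_on_def
    by (smt (verit) at_within_open centre_in_ball field_differentiable_at_within holomorphic_on_open
       mem_Collect_eq open_ball)
qed

lemma holomorphic_theta3: "theta3 (of_real x) holomorphic_on {\<tau>. Im \<tau> > 0}"
proof -
  have "theta3 (of_real x) = (\<lambda>\<tau>. \<Sum>\<^sub>\<infinity>n | even n. theta_term x \<tau> n)"
    by (rule ext) (rule theta3_eq_even_sum)
  then show ?thesis
    by (simp only: holomorphic_theta_term_sum)
qed

lemma holomorphic_theta2: "theta2 (of_real x) holomorphic_on {\<tau>. Im \<tau> > 0}"
proof -
  have "theta2 (of_real x) = (\<lambda>\<tau>. \<Sum>\<^sub>\<infinity>n | odd n. theta_term x \<tau> n)"
    by (rule ext) (rule theta2_eq_odd_sum)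
  then show ?thesis
    by (simp only: holomorphic_theta_term_sum)
qed

section \<open>Behaviour at the cusp\<close>

text \<open>
  Neighbourhoods of the cusp are the half planes Im \<tau> \<ge> c.  They are stable under \<tau> \<mapsto> 2\<tau>, which
  is what allows descent along the iterates of doubling.
\<close>

definition at_cusp :: "complex filter" where
  "at_cusp = filtercomap Im at_top"

lemma eventually_at_cusp: "eventually P at_cusp \<longleftrightarrow> (\<exists>c. \<forall>\<tau>. Im \<tau> \<ge> c \<longrightarrow> P \<tau>)"
  by (auto simp: at_cusp_def eventually_filtercomap_at_top_linorder)

lemma at_cusp_neq_bot [simp]: "at_cusp \<noteq> bot"
proof -
  have "\<exists>\<tau>. Im \<tau> \<ge> c" for c
    by (rule exI[of _ "Complex 0 c"]) simp
  then show ?thesis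
    by (auto simp: trivial_limit_def eventually_at_cusp)
qed

lemma filterlim_scale_at_cusp:
  assumes "c > 0"
  shows "filterlim (\<lambda>\<tau>. of_real c * \<tau>) at_cusp at_cusp"
proof -
  have "filterlim (\<lambda>\<tau>. c * Im \<tau>) at_top at_cusp"
    unfolding at_cusp_def
    by (rule filterlim_tendsto_pos_mult_at_top[OF tendsto_const assms filterlim_filtercomap])
  then show ?thesis
    by (subst (1) at_cusp_def) (simp add: filterlim_filtercomap_iff o_def)
qed

lemma eventually_at_cusp_Im_ge: "eventually (\<lambda>\<tau>. Im \<tau> \<ge> c) at_cusp"
  by (auto simp: eventually_at_cusp)

lemma exp_tendsto_0_at_cusp:
  assumes "c > 0"
  shows "((\<lambda>\<tau>. exp (\<i> * of_real c * \<tau>)) \<longlongrightarrow> 0) at_cusp"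
proof (rule tendsto_norm_zero_cancel)
  have "filterlim (\<lambda>\<tau>. c * Im \<tau>) at_top at_cusp"
    unfolding at_cusp_def
    by (rule filterlim_tendsto_pos_mult_at_top[OF tendsto_const assms filterlim_filtercomap])
  then have "((\<lambda>\<tau>. exp (- (c * Im \<tau>))) \<longlongrightarrow> 0) at_cusp"
    by (intro filterlim_compose[OF exp_at_bot]) (simp add: filterlim_uminus_at_bot)
  then show "((\<lambda>\<tau>. norm (exp (\<i> * of_real c * \<tau>))) \<longlongrightarrow> 0) at_cusp"
    by simp
qed

text \<open>
  Tannery's theorem: after division by the smallest power of the nome, every term with
  n^2 > d dies at the cusp, and for Im \<tau> \<ge> 1 all terms are dominated by a geometric series.
\<close>

lemma theta_term_sum_tendsto:
  fixes A :: "int set" and d :: nat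
  assumes d: "\<And>n. n \<in> A \<Longrightarrow> int d \<le> n ^ 2"
  shows "((\<lambda>\<tau>. (\<Sum>\<^sub>\<infinity>n\<in>A. theta_term x \<tau> n) * exp (- (\<i> * of_real (pi * d / 2) * \<tau>)))
    \<longlongrightarrow> (\<Sum>n | n \<in> A \<and> n ^ 2 = int d. exp (\<i> * of_int n * of_real x))) at_cusp"
proof -
  define h where "h \<tau> n = theta_term x \<tau> n * exp (- (\<i> * of_real (pi * d / 2) * \<tau>))" for \<tau> n
  define L where "L n = (if n ^ 2 = int d then exp (\<i> * of_int n * of_real x) else 0)" for n
  have h_eq: "h \<tau> n = exp (\<i> * of_int n * of_real x) * exp (\<i> * of_real (pi / 2 * real_of_int (n ^ 2 - int d)) * \<tau>)" for \<tau> n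
    unfolding h_def theta_term_def exp_add[symmetric]
    by (intro arg_cong[where f = exp]) (simp add: algebra_simps diff_divide_distrib add_divide_distrib)
  have fin: "finite {n::int. n ^ 2 = int d}"
  proof (rule finite_subset)
    show "{n::int. n ^ 2 = int d} \<subseteq> {- int d..int d}"
    proof
      fix n assume "n \<in> {n::int. n ^ 2 = int d}"
      then show "n \<in> {- int d..int d}"
        using abs_le_square_int[of n] by (auto simp: abs_le_iff)
    qed
  qed simp
  have lim: "((\<lambda>\<tau>. h \<tau> n) \<longlongrightarrow> L n) at_cusp" if "n \<in> A" for n
  proof (cases "n ^ 2 = int d")
    case True
    then show ?thesis by (simp add: h_eq L_def)
  next
    case False
    then have "0 < n ^ 2 - int d"
      using d[OF that] by simp
    then have "0 < pi / 2 * real_of_int (n ^ 2 - int d)"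
      by (intro mult_pos_pos) (simp_all only: of_int_0_less_iff pi_half_gt_zero)
    from exp_tendsto_0_at_cusp[OF this] show ?thesis
      unfolding h_eq L_def using False by (auto intro: tendsto_mult_right_zero)
  qed
  have ulim: "uniform_limit {\<tau>. 1 \<le> Im \<tau>} (\<lambda>X \<tau>. \<Sum>n\<in>X. h \<tau> n) (\<lambda>\<tau>. \<Sum>\<^sub>\<infinity>n\<in>A. h \<tau> n) (finite_subsets_at_top A)"
  proof (rule Weierstrass_m_test_general)
    have "(\<lambda>n::int. exp (- (pi / 2)) ^ nat \<bar>n\<bar>) summable_on UNIV"
      by (rule summable_on_power_abs_int) simp_all
    then have "(\<lambda>n::int. exp (- (pi / 2)) ^ nat \<bar>n\<bar>) summable_on A"
      by (rule summable_on_subset_banach) auto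
    then show "(\<lambda>n. exp (pi * d / 2) * exp (- (pi / 2)) ^ nat \<bar>n\<bar>) summable_on A"
      by (rule summable_on_cmult_right)
    fix n \<tau> assume n: "n \<in> A" and \<tau>: "\<tau> \<in> {\<tau>. 1 \<le> Im \<tau>}"
    have "0 \<le> real_of_int (n ^ 2 - int d)"
      using d[OF n] by (simp only: of_int_0_le_iff diff_ge_0_iff_ge)
    then have 1: "real_of_int (n ^ 2 - int d) * 1 \<le> real_of_int (n ^ 2 - int d) * Im \<tau>"
      using \<tau> by (intro mult_left_mono) auto
    have "real_of_int \<bar>n\<bar> \<le> of_int (n ^ 2)"
      using abs_le_square_int[of n] of_int_le_iff by blast
    with 1 have "pi / 2 * (real_of_int \<bar>n\<bar> - d) \<le> pi / 2 * (real_of_int (n ^ 2 - int d) * Im \<tau>)"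
      by (intro mult_left_mono) auto
    then show "norm (h \<tau> n) \<le> exp (pi * d / 2) * exp (- (pi / 2)) ^ nat \<bar>n\<bar>"
      by (simp add: h_eq norm_mult exp_of_nat_mult[symmetric] exp_add[symmetric] algebra_simps)
  qed
  have sum_L: "((\<lambda>X. \<Sum>n\<in>X. L n) \<longlongrightarrow> (\<Sum>n | n \<in> A \<and> n ^ 2 = int d. exp (\<i> * of_int n * of_real x)))
      (finite_subsets_at_top A)"
  proof -
    have "(L has_sum (\<Sum>n | n \<in> A \<and> n ^ 2 = int d. exp (\<i> * of_int n * of_real x))) {n. n \<in> A \<and> n ^ 2 = int d}"
      by (rule has_sum_finiteI) (auto intro: finite_subset[OF _ fin] simp: L_def)
    then have "(L has_sum (\<Sum>n | n \<in> A \<and> n ^ 2 = int d. exp (\<i> * of_int n * of_real x))) A"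
      by (rule has_sum_cong_neutral[THEN iffD1, rotated -1]) (auto simp: L_def)
    then show ?thesis by (simp add: has_sum_def)
  qed
  have "\<forall>\<^sub>F X in finite_subsets_at_top A. ((\<lambda>\<tau>. \<Sum>n\<in>X. h \<tau> n) \<longlongrightarrow> (\<Sum>n\<in>X. L n)) at_cusp"
    by (rule eventually_finite_subsets_at_top_weakI) (auto intro!: tendsto_sum lim)
  then have "((\<lambda>\<tau>. \<Sum>\<^sub>\<infinity>n\<in>A. h \<tau> n) \<longlongrightarrow> (\<Sum>n | n \<in> A \<and> n ^ 2 = int d. exp (\<i> * of_int n * of_real x))) at_cusp"
    by (rule swap_uniform_limit'[OF _ sum_L ulim]) (simp_all add: eventually_at_cusp_Im_ge)
  then show ?thesis
    by (simp add: h_def infsum_cmult_left')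
qed

lemma theta3_tendsto: "(theta3 (of_real x) \<longlongrightarrow> 1) at_cusp"
proof -
  have "theta3 (of_real x) = (\<lambda>\<tau>. \<Sum>\<^sub>\<infinity>n | even n. theta_term x \<tau> n)"
    by (rule ext) (rule theta3_eq_even_sum)
  moreover have "{n::int. n = 0 \<and> even n} = {0}" "{n::int. even n \<and> n = 0} = {0}" by auto
  ultimately show ?thesis
    using theta_term_sum_tendsto[of "{n. even n}" 0 x] by simp
qed

lemma theta2_tendsto: "((\<lambda>\<tau>. theta2 (of_real x) \<tau> * exp (- (\<i> * of_real (pi / 2) * \<tau>))) \<longlongrightarrow> of_real (2 * cos x)) at_cusp"
proof -
  have "{n::int. odd n \<and> n ^ 2 = int 1} = {1, - 1}" by (auto simp: power2_eq_1_iff)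
  moreover have "int 1 \<le> n\<^sup>2" if "odd n" for n :: int
    using that by (cases "n = 0") (auto simp: int_one_le_iff_zero_less)
  moreover have "exp (\<i> * of_real x) + exp (- (\<i> * of_real x)) = of_real (2 * cos x)"
    by (simp add: cos_of_real[symmetric] cos_exp_eq)
  ultimately show ?thesis
    using theta_term_sum_tendsto[of "{n. odd n}" 1 x]
    by (simp add: theta2_eq_odd_sum)
qed

section \<open>Algebra of the curve\<close>

text \<open>
  Here (u, r) and (\<kappa>, \<rho>) stand for the quotients at \<tau> and at 2\<tau>.  Eliminating u and r leaves a polynomial
  relation that contains the factor \<kappa> + \<rho>: the doubling relations alone cannot distinguish the point of order
  three from the trivial point, where the quotient at 2\<pi>/3 would equal the one at 0, that is, -\<rho> = \<kappa>.
  The remaining factor is the equation of the curve.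
\<close>

lemma doubling_imp_curve:
  fixes u r \<kappa> \<rho> :: complex
  assumes u: "u\<^sup>2 * (1 + \<kappa>\<^sup>2) = 2 * \<kappa>" and r: "r\<^sup>2 * (1 - \<kappa> * \<rho>) = \<kappa> - \<rho>"
    and ur: "u * r * (1 + \<rho>\<^sup>2) = 2 * \<rho>" and nz: "\<kappa> + \<rho> \<noteq> 0"
  shows "\<kappa> * (1 - \<rho> ^ 4) = 2 * \<rho> * (1 - \<kappa>\<^sup>2 * \<rho>\<^sup>2)"
proof -
  have "(u * r * (1 + \<rho>\<^sup>2))\<^sup>2 * (1 + \<kappa>\<^sup>2) * (1 - \<kappa> * \<rho>) =
      (u\<^sup>2 * (1 + \<kappa>\<^sup>2)) * (r\<^sup>2 * (1 - \<kappa> * \<rho>)) * (1 + \<rho>\<^sup>2)\<^sup>2"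
    by (simp add: power_mult_distrib mult_ac)
  then have "(2 * \<rho>)\<^sup>2 * (1 + \<kappa>\<^sup>2) * (1 - \<kappa> * \<rho>) = 2 * \<kappa> * (\<kappa> - \<rho>) * (1 + \<rho>\<^sup>2)\<^sup>2"
    unfolding u r ur .
  then have "2 * ((\<kappa> + \<rho>) * (\<kappa> * (1 - \<rho> ^ 4) - 2 * \<rho> * (1 - \<kappa>\<^sup>2 * \<rho>\<^sup>2))) = 0"
    by algebra
  with nz show ?thesis by simp
qed

text \<open>
  If v is the quotient at 3\<tau> then v obeys the doubling relation satisfied by u.  So does u r^2, by the curve.
\<close>

lemma curve_imp_triple_doubling:
  fixes u r \<kappa> \<rho> :: complex
  assumes u: "u\<^sup>2 * (1 + \<kappa>\<^sup>2) = 2 * \<kappa>" and r: "r\<^sup>2 * (1 - \<kappa> * \<rho>) = \<kappa> - \<rho>"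
    and curve: "\<kappa> * (1 - \<rho> ^ 4) = 2 * \<rho> * (1 - \<kappa>\<^sup>2 * \<rho>\<^sup>2)"
    and nz: "1 + \<kappa>\<^sup>2 \<noteq> 0" "1 - \<kappa> * \<rho> \<noteq> 0"
  shows "(u * r\<^sup>2)\<^sup>2 * (1 + (\<kappa> * \<rho>\<^sup>2)\<^sup>2) = 2 * (\<kappa> * \<rho>\<^sup>2)"
proof -
  have "(u * r\<^sup>2)\<^sup>2 * (1 + (\<kappa> * \<rho>\<^sup>2)\<^sup>2) * ((1 + \<kappa>\<^sup>2) * (1 - \<kappa> * \<rho>)\<^sup>2) =
      (u\<^sup>2 * (1 + \<kappa>\<^sup>2)) * (r\<^sup>2 * (1 - \<kappa> * \<rho>))\<^sup>2 * (1 + (\<kappa> * \<rho>\<^sup>2)\<^sup>2)"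
    by (simp add: power_mult_distrib mult_ac)
  also have "\<dots> = 2 * \<kappa> * (\<kappa> - \<rho>)\<^sup>2 * (1 + (\<kappa> * \<rho>\<^sup>2)\<^sup>2)"
    unfolding u r ..
  also have "\<dots> = 2 * (\<kappa> * \<rho>\<^sup>2) * ((1 + \<kappa>\<^sup>2) * (1 - \<kappa> * \<rho>)\<^sup>2)"
    using curve by algebra
  finally show ?thesis
    using nz by simp
qed

text \<open>
  By the addition formula at the origin, (1 + \<kappa>^2) / (1 + \<kappa>^2 \<rho>^4) is the factor that relates
  \<theta>3(0,\<tau>)^2 / \<theta>3(0,3\<tau>)^2 to its value at 2\<tau>; the multiplier 1 + 2 u r^3 must follow it.
\<close>

lemma curve_imp_multiplier_doubling:
  fixes u r \<kappa> \<rho> :: complex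
  assumes r: "r\<^sup>2 * (1 - \<kappa> * \<rho>) = \<kappa> - \<rho>" and ur: "u * r * (1 + \<rho>\<^sup>2) = 2 * \<rho>"
    and curve: "\<kappa> * (1 - \<rho> ^ 4) = 2 * \<rho> * (1 - \<kappa>\<^sup>2 * \<rho>\<^sup>2)"
    and nz: "1 + \<rho>\<^sup>2 \<noteq> 0" "1 - \<kappa> * \<rho> \<noteq> 0"
  shows "(1 + 2 * (u * r ^ 3)) * (1 + (\<kappa> * \<rho>\<^sup>2)\<^sup>2) = (1 + 2 * (\<kappa> * \<rho> ^ 3)) * (1 + \<kappa>\<^sup>2)"
proof -
  have "(1 + 2 * (u * r ^ 3)) * ((1 + \<rho>\<^sup>2) * (1 - \<kappa> * \<rho>)) =
      (1 + \<rho>\<^sup>2) * (1 - \<kappa> * \<rho>) + 2 * (u * r * (1 + \<rho>\<^sup>2)) * (r\<^sup>2 * (1 - \<kappa> * \<rho>))"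
    by (simp add: algebra_simps power2_eq_square power3_eq_cube)
  also have "\<dots> = (1 + \<rho>\<^sup>2) * (1 - \<kappa> * \<rho>) + 4 * \<rho> * (\<kappa> - \<rho>)"
    unfolding r ur by simp
  finally have "(1 + 2 * (u * r ^ 3)) * (1 + (\<kappa> * \<rho>\<^sup>2)\<^sup>2) * ((1 + \<rho>\<^sup>2) * (1 - \<kappa> * \<rho>)) =
      ((1 + \<rho>\<^sup>2) * (1 - \<kappa> * \<rho>) + 4 * \<rho> * (\<kappa> - \<rho>)) * (1 + (\<kappa> * \<rho>\<^sup>2)\<^sup>2)"
    by algebra
  also have "\<dots> = (1 + 2 * (\<kappa> * \<rho> ^ 3)) * (1 + \<kappa>\<^sup>2) * ((1 + \<rho>\<^sup>2) * (1 - \<kappa> * \<rho>))"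
    using curve by algebra
  finally show ?thesis
    using nz by simp
qed

text \<open>
  Equality of two products in a quadratic extension, read off from the coefficients of 1 and s.
\<close>

lemma linear_product_eq:
  fixes s :: complex
  assumes S: "s\<^sup>2 = S"
    and "(a1 * a2 + b1 * b2 * S) * d = e1 * a3 + f1 * b3 * S"
    and "(a1 * b2 + a2 * b1) * d = e1 * b3 + f1 * a3"
  shows "(a1 + b1 * s) * (a2 + b2 * s) * d = (e1 + f1 * s) * (a3 + b3 * s)"
proof -
  have "(a1 + b1 * s) * (a2 + b2 * s) * d = (a1 * a2 + b1 * b2 * s\<^sup>2) * d + (a1 * b2 + a2 * b1) * d * s"
    by (simp add: algebra_simps power2_eq_square)
  also have "\<dots> = (e1 * a3 + f1 * b3 * s\<^sup>2) + (e1 * b3 + f1 * a3) * s"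
    unfolding S assms(2,3) ..
  also have "\<dots> = (e1 + f1 * s) * (a3 + b3 * s)"
    by (simp add: algebra_simps power2_eq_square)
  finally show ?thesis .
qed

text \<open>
  With p = u r^3, the classical parameter of the modular equation of degree three, the function field of the
  curve in (u^2, r^2) is generated by p and s = r^2, and s is quadratic over the rational functions of p.
  Every product of w = u^2 and s occurring below is a rational function of p, or s times one.
\<close>

lemma curve_parametrization:
  fixes u r :: complex
  assumes curve: "u * (1 - r ^ 4) = 2 * r * (1 - u\<^sup>2 * r\<^sup>2)"
    and "p = u * r ^ 3" "s = r\<^sup>2" "w = u\<^sup>2" "D = 1 + 2 * p"
    and nz: "u \<noteq> 0" "r \<noteq> 0" "D \<noteq> 0" "2 + p \<noteq> 0"
  shows "s\<^sup>2 = p * D / (2 + p)" "w = (2 + p)\<^sup>2 / D\<^sup>2 * s"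
    "w * s = p * (2 + p) / D" "w\<^sup>2 = p * (2 + p) ^ 3 / D ^ 3"
    "w * s ^ 3 = p\<^sup>2" "w\<^sup>2 * s ^ 4 = p ^ 3 * (2 + p) / D"
proof -
  have "s\<^sup>2 * (2 + p) = p * D"
    using curve unfolding assms(2-5) by algebra
  then show s2: "s\<^sup>2 = p * D / (2 + p)"
    using nz by (simp add: field_simps)
  have "w * s * D = p * (2 + p)"
    using curve unfolding assms(2-5) by algebra
  then show ws: "w * s = p * (2 + p) / D"
    using nz by (simp add: field_simps)
  have "p \<noteq> 0" using assms by simp
  have "p * (w * D\<^sup>2) = p * ((2 + p)\<^sup>2 * s)"
    using \<open>w * s * D = p * (2 + p)\<close> \<open>s\<^sup>2 * (2 + p) = p * D\<close> by algebra
  then have "w * D\<^sup>2 = (2 + p)\<^sup>2 * s"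
    using \<open>p \<noteq> 0\<close> by simp
  then show w: "w = (2 + p)\<^sup>2 / D\<^sup>2 * s"
    using nz by (simp add: field_simps)
  have "((2 + p) * D) * (w\<^sup>2 * D ^ 3) = ((2 + p) * D) * (p * (2 + p) ^ 3)"
    using \<open>w * D\<^sup>2 = (2 + p)\<^sup>2 * s\<close> \<open>s\<^sup>2 * (2 + p) = p * D\<close> by algebra
  then have "w\<^sup>2 * D ^ 3 = p * (2 + p) ^ 3"
    using nz by simp
  then show "w\<^sup>2 = p * (2 + p) ^ 3 / D ^ 3"
    using nz by (simp add: field_simps)
  show ws3: "w * s ^ 3 = p\<^sup>2"
    unfolding assms(2-5) by algebra
  have "w\<^sup>2 * s ^ 4 = (w * s) * (w * s ^ 3)"
    by algebra
  then show "w\<^sup>2 * s ^ 4 = p ^ 3 * (2 + p) / D"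
    unfolding ws ws3 by (simp add: power2_eq_square power3_eq_cube)
qed

text \<open>
  This and the next lemma are the two nontrivial identities of the theorem after clearing denominators.
  Each factor is written as \<alpha> + \<beta> s with \<alpha>, \<beta> rational in p, so that only identities between rational
  functions of p remain.
\<close>

lemma curve_sum_identity:
  fixes u r :: complex
  assumes "u * (1 - r ^ 4) = 2 * r * (1 - u\<^sup>2 * r\<^sup>2)"
    and p: "p = u * r ^ 3" and s: "s = r\<^sup>2" and w: "w = u\<^sup>2" and D: "D = 1 + 2 * p"
    and nz: "u \<noteq> 0" "r \<noteq> 0" "D \<noteq> 0" "2 + p \<noteq> 0"
  shows "2 * w * (3 + w + 2 * s) * ((1 + w) * D\<^sup>2 - 9 * s * (1 + w * s\<^sup>2)) * D\<^sup>2 =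
    3 * s * (1 + w * s\<^sup>2) * (D\<^sup>2 * (6 * w * s * (1 + w) - (1 + 6 * w + w\<^sup>2)) - 9 * (5 * w\<^sup>2 * s ^ 4 - 1))"
proof -
  note par = curve_parametrization[OF assms]
  define K where "K = (2 + p)\<^sup>2 / D\<^sup>2"
  have w_eq: "w = K * s" using par(2) by (simp add: K_def)
  \<comment> \<open>w is a multiple of s, so even powers of w and s combine to rational functions of p\<close>
  have f1: "2 * w * (3 + w + 2 * s) = (2 * w\<^sup>2 + 4 * (w * s)) + 6 * K * s"
    unfolding w_eq by (simp add: algebra_simps power2_eq_square)
  have f2: "(1 + w) * D\<^sup>2 - 9 * s * (1 + w * s\<^sup>2) = (D\<^sup>2 - 9 * (w * s ^ 3)) + (K * D\<^sup>2 - 9) * s"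
    unfolding w_eq by (simp add: algebra_simps power2_eq_square power3_eq_cube)
  have f3: "3 * s * (1 + w * s\<^sup>2) = 3 * (w * s ^ 3) + 3 * s"
    by (simp add: algebra_simps power2_eq_square power3_eq_cube)
  have f4: "D\<^sup>2 * (6 * w * s * (1 + w) - (1 + 6 * w + w\<^sup>2)) - 9 * (5 * w\<^sup>2 * s ^ 4 - 1) =
     (D\<^sup>2 * (6 * (w * s) - 1 - w\<^sup>2) - 9 * (5 * (w\<^sup>2 * s ^ 4) - 1)) + D\<^sup>2 * (6 * K * (w * s) - 6 * K) * s"
  proof -
    have "6 * w * s * (1 + w) = 6 * (w * s) + 6 * K * (w * s) * s" "6 * w = 6 * K * s"
      by (simp_all add: w_eq algebra_simps)
    then show ?thesis by (simp only: algebra_simps)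
  qed
  have D': "p = (D - 1) / 2" using D by simp
  show ?thesis
    unfolding f1 f2 f3 f4
  proof (rule linear_product_eq[OF par(1)])
    show "((2 * w\<^sup>2 + 4 * (w * s)) * (D\<^sup>2 - 9 * (w * s ^ 3)) + 6 * K * (K * D\<^sup>2 - 9) * (p * D / (2 + p))) * D\<^sup>2 =
      3 * (w * s ^ 3) * (D\<^sup>2 * (6 * (w * s) - 1 - w\<^sup>2) - 9 * (5 * (w\<^sup>2 * s ^ 4) - 1)) +
      3 * (D\<^sup>2 * (6 * K * (w * s) - 6 * K)) * (p * D / (2 + p))"
      unfolding par(6) unfolding par(3-5) K_def using nz(3,4)
      by (simp add: divide_simps) (use D in algebra)
    show "((2 * w\<^sup>2 + 4 * (w * s)) * (K * D\<^sup>2 - 9) + (D\<^sup>2 - 9 * (w * s ^ 3)) * (6 * K)) * D\<^sup>2 =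
      3 * (w * s ^ 3) * (D\<^sup>2 * (6 * K * (w * s) - 6 * K)) +
      3 * (D\<^sup>2 * (6 * (w * s) - 1 - w\<^sup>2) - 9 * (5 * (w\<^sup>2 * s ^ 4) - 1))"
      unfolding par(6) unfolding par(3-5) K_def using nz(3,4)
      by (simp add: divide_simps) (use D in algebra)
  qed
qed

lemma curve_pair_sum_identity:
  fixes u r :: complex
  assumes "u * (1 - r ^ 4) = 2 * r * (1 - u\<^sup>2 * r\<^sup>2)"
    and p: "p = u * r ^ 3" and s: "s = r\<^sup>2" and w: "w = u\<^sup>2" and D: "D = 1 + 2 * p"
    and nz: "u \<noteq> 0" "r \<noteq> 0" "D \<noteq> 0" "2 + p \<noteq> 0"
  shows "2 * (s + 2 * w + 3 * w * s) * ((1 + w) * D\<^sup>2 - 9 * s * (1 + w * s\<^sup>2)) * D\<^sup>2 =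
    3 * s * (1 + w * s\<^sup>2) * (D\<^sup>2 * (6 * (1 + w) - s * (1 + 6 * w + w\<^sup>2)) - 9 * s * (5 - w\<^sup>2 * s ^ 4))"
proof -
  note par = curve_parametrization[OF assms]
  define K where "K = (2 + p)\<^sup>2 / D\<^sup>2"
  have w_eq: "w = K * s" using par(2) by (simp add: K_def)
  have f1: "2 * (s + 2 * w + 3 * w * s) = 6 * (w * s) + (2 + 4 * K) * s"
    unfolding w_eq by (simp add: algebra_simps power2_eq_square)
  have f2: "(1 + w) * D\<^sup>2 - 9 * s * (1 + w * s\<^sup>2) = (D\<^sup>2 - 9 * (w * s ^ 3)) + (K * D\<^sup>2 - 9) * s"
    unfolding w_eq by (simp add: algebra_simps power2_eq_square power3_eq_cube)
  have f3: "3 * s * (1 + w * s\<^sup>2) = 3 * (w * s ^ 3) + 3 * s"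
    by (simp add: algebra_simps power2_eq_square power3_eq_cube)
  have f4: "D\<^sup>2 * (6 * (1 + w) - s * (1 + 6 * w + w\<^sup>2)) - 9 * s * (5 - w\<^sup>2 * s ^ 4) =
     D\<^sup>2 * (6 - 6 * (w * s)) + (D\<^sup>2 * (6 * K - 1 - w\<^sup>2) - 45 + 9 * (w\<^sup>2 * s ^ 4)) * s"
  proof -
    have "6 * w = 6 * K * s"
      by (simp add: w_eq)
    then have "6 * (1 + w) - s * (1 + 6 * w + w\<^sup>2) = 6 + 6 * K * s - s - 6 * (w * s) - s * w\<^sup>2"
      by (simp add: algebra_simps)
    then show ?thesis by (simp add: algebra_simps)
  qed
  show ?thesis
    unfolding f1 f2 f3 f4
  proof (rule linear_product_eq[OF par(1)])
    show "(6 * (w * s) * (D\<^sup>2 - 9 * (w * s ^ 3)) + (2 + 4 * K) * (K * D\<^sup>2 - 9) * (p * D / (2 + p))) * D\<^sup>2 =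
      3 * (w * s ^ 3) * (D\<^sup>2 * (6 - 6 * (w * s))) +
      3 * (D\<^sup>2 * (6 * K - 1 - w\<^sup>2) - 45 + 9 * (w\<^sup>2 * s ^ 4)) * (p * D / (2 + p))"
      unfolding par(6) unfolding par(3-5) K_def using nz(3,4)
      by (simp add: divide_simps) (use D in algebra)
    show "(6 * (w * s) * (K * D\<^sup>2 - 9) + (D\<^sup>2 - 9 * (w * s ^ 3)) * (2 + 4 * K)) * D\<^sup>2 =
      3 * (w * s ^ 3) * (D\<^sup>2 * (6 * K - 1 - w\<^sup>2) - 45 + 9 * (w\<^sup>2 * s ^ 4)) +
      3 * (D\<^sup>2 * (6 - 6 * (w * s)))"
      unfolding par(6) unfolding par(3-5) K_def using nz(3,4)
      by (simp add: divide_simps) (use D in algebra)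
  qed
qed

section \<open>Theta quotients and their doubling relations\<close>

text \<open>
  Up to a factor independent of x this is the elliptic function cd = cn/dn.  At x = k\<pi>/12 its square is
  \<beta>_k.
\<close>

definition theta_quot :: "real \<Rightarrow> complex \<Rightarrow> complex" where
  "theta_quot x \<tau> = theta2 (of_real x) \<tau> / theta3 (of_real x) \<tau>"

text \<open>
  The fourth root of the nome, the leading term of \<theta>2 at the cusp up to a factor 2 cos x.
\<close>

definition nome4 :: "complex \<Rightarrow> complex" where
  "nome4 \<tau> = exp (\<i> * of_real (pi / 2) * \<tau>)"

lemma nome4_nonzero [simp]: "nome4 \<tau> \<noteq> 0"
  by (simp add: nome4_def)

lemma nome4_scale: "nome4 (of_nat k * \<tau>) = nome4 \<tau> ^ k"
  by (simp add: nome4_def exp_of_nat_mult[symmetric] mult_ac)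

lemma nome4_tendsto: "(nome4 \<longlongrightarrow> 0) at_cusp"
  using exp_tendsto_0_at_cusp[of "pi / 2"] by (simp add: nome4_def[abs_def])

lemma eventually_at_cusp_scale:
  assumes "c > 0"
  shows "eventually (\<lambda>\<tau>. P (of_real c * \<tau>)) at_cusp \<longleftrightarrow> eventually P at_cusp"
proof
  assume "eventually (\<lambda>\<tau>. P (of_real c * \<tau>)) at_cusp"
  then have "eventually (\<lambda>\<tau>. P (of_real c * (of_real (1 / c) * \<tau>))) at_cusp"
    by (rule filterlim_iff[THEN iffD1, rule_format, OF filterlim_scale_at_cusp, rotated]) (use assms in simp)
  then show "eventually P at_cusp"
    using assms by simp
next
  assume "eventually P at_cusp"
  then show "eventually (\<lambda>\<tau>. P (of_real c * \<tau>)) at_cusp"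
    by (rule filterlim_iff[THEN iffD1, rule_format, OF filterlim_scale_at_cusp[OF assms]])
qed

lemma filterlim_at_cusp_numeral: "filterlim (\<lambda>\<tau>. numeral k * \<tau>) at_cusp at_cusp"
  using filterlim_scale_at_cusp[of "numeral k"] by simp

lemma eventually_at_cusp_double: "eventually (\<lambda>\<tau>. P (2 * \<tau>)) at_cusp \<longleftrightarrow> eventually P at_cusp"
  using eventually_at_cusp_scale[of 2 P] by simp

lemma eventually_theta3_nonzero: "\<forall>\<^sub>F \<tau> in at_cusp. theta3 (of_real x) \<tau> \<noteq> 0"
  by (rule tendsto_imp_eventually_ne[OF theta3_tendsto]) simp

lemma theta_quot_nome_tendsto: "((\<lambda>\<tau>. theta_quot x \<tau> / nome4 \<tau>) \<longlongrightarrow> of_real (2 * cos x)) at_cusp"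
proof -
  have "((\<lambda>\<tau>. theta2 (of_real x) \<tau> * exp (- (\<i> * of_real (pi / 2) * \<tau>)) / theta3 (of_real x) \<tau>)
      \<longlongrightarrow> of_real (2 * cos x) / 1) at_cusp"
    by (intro tendsto_divide theta2_tendsto theta3_tendsto) simp
  moreover have "theta2 (of_real x) \<tau> * exp (- (\<i> * of_real (pi / 2) * \<tau>)) / theta3 (of_real x) \<tau> =
      theta_quot x \<tau> / nome4 \<tau>" for \<tau>
    by (simp add: theta_quot_def nome4_def exp_minus field_simps)
  ultimately show ?thesis by simp
qed

lemma theta_quot_tendsto: "(theta_quot x \<longlongrightarrow> 0) at_cusp"
proof -
  have "((\<lambda>\<tau>. theta_quot x \<tau> / nome4 \<tau> * nome4 \<tau>) \<longlongrightarrow> of_real (2 * cos x) * 0) at_cusp"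
    by (intro tendsto_mult theta_quot_nome_tendsto nome4_tendsto)
  then show ?thesis by simp
qed

lemma theta_quot_0_tendsto: "((\<lambda>\<tau>. theta_quot 0 \<tau> / nome4 \<tau>) \<longlongrightarrow> 2) at_cusp"
  using theta_quot_nome_tendsto[of 0] by simp

lemma theta_quot_pi_third_tendsto: "((\<lambda>\<tau>. theta_quot (pi / 3) \<tau> / nome4 \<tau>) \<longlongrightarrow> 1) at_cusp"
  using theta_quot_nome_tendsto[of "pi / 3"] by (simp add: cos_60)

lemma theta_quot_pi_minus: "theta_quot (pi - x) \<tau> = - theta_quot x \<tau>"
  unfolding theta_quot_def theta2_pi_minus theta3_pi_minus by simp

text \<open>
  Quotient of the two addition formulas.  The doubling relations for u and r are its special cases.
\<close>

lemma eventually_theta_quot_addition: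
  "\<forall>\<^sub>F \<tau> in at_cusp. theta_quot (x + y) \<tau> * theta_quot (x - y) \<tau> *
      (1 + theta_quot (2 * x) (2 * \<tau>) * theta_quot (2 * y) (2 * \<tau>)) =
    theta_quot (2 * x) (2 * \<tau>) + theta_quot (2 * y) (2 * \<tau>)"
  using eventually_at_cusp_Im_ge[of 1] eventually_theta3_nonzero[of "x + y"] eventually_theta3_nonzero[of "x - y"]
    eventually_at_cusp_double[THEN iffD2, OF eventually_theta3_nonzero[of "2 * x"]]
    eventually_at_cusp_double[THEN iffD2, OF eventually_theta3_nonzero[of "2 * y"]]
proof eventually_elim
  case (elim \<tau>)
  have "Im \<tau> > 0" using elim by simp
  define a b c d where "a = theta2 (of_real (2 * x)) (2 * \<tau>)" "b = theta3 (of_real (2 * x)) (2 * \<tau>)"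
    "c = theta2 (of_real (2 * y)) (2 * \<tau>)" "d = theta3 (of_real (2 * y)) (2 * \<tau>)"
  define P where "P = theta3 (of_real (x + y)) \<tau> * theta3 (of_real (x - y)) \<tau>"
  have nz: "b \<noteq> 0" "d \<noteq> 0" "P \<noteq> 0"
    using elim by (auto simp: a_b_c_d_def P_def)
  have P: "P = b * d + a * c"
    using theta3_addition[OF \<open>Im \<tau> > 0\<close>, of x y] by (simp add: P_def a_b_c_d_def)
  have "theta_quot (x + y) \<tau> * theta_quot (x - y) \<tau> = (a * d + b * c) / P"
    unfolding theta_quot_def times_divide_times_eq P_def a_b_c_d_def
    by (rule arg_cong2[where f = "(/)", OF theta2_addition[OF \<open>Im \<tau> > 0\<close>] refl])
  moreover have "theta_quot (2 * x) (2 * \<tau>) = a / b" "theta_quot (2 * y) (2 * \<tau>) = c / d"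
    by (simp_all only: theta_quot_def a_b_c_d_def)
  moreover have "(a * d + b * c) / P * (1 + a / b * (c / d)) = a / b + c / d"
  proof -
    have "1 + a / b * (c / d) = P / (b * d)"
      using nz by (simp add: P field_simps)
    moreover have "a / b + c / d = (a * d + b * c) / (b * d)"
      using nz by (simp add: field_simps)
    ultimately show ?thesis using nz by simp
  qed
  ultimately show ?case by simp
qed

abbreviation u :: "complex \<Rightarrow> complex" where "u \<equiv> theta_quot 0"
abbreviation r :: "complex \<Rightarrow> complex" where "r \<equiv> theta_quot (pi / 3)"

lemma theta_quot_2pi_third: "theta_quot (2 * (pi / 3)) \<tau> = - r \<tau>"
proof -
  have "pi - pi / 3 = 2 * (pi / 3)" by simp
  with theta_quot_pi_minus[of "pi / 3" \<tau>] show ?thesis by simp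
qed

lemma eventually_u_double: "\<forall>\<^sub>F \<tau> in at_cusp. u \<tau> ^ 2 * (1 + u (2 * \<tau>) ^ 2) = 2 * u (2 * \<tau>)"
  using eventually_theta_quot_addition[of 0 0] by (simp add: power2_eq_square)

lemma eventually_r_double:
  "\<forall>\<^sub>F \<tau> in at_cusp. r \<tau> ^ 2 * (1 - u (2 * \<tau>) * r (2 * \<tau>)) = u (2 * \<tau>) - r (2 * \<tau>)"
  using eventually_theta_quot_addition[of "pi / 3" 0]
  unfolding theta_quot_2pi_third by (simp add: power2_eq_square mult_ac)

lemma eventually_ur_double:
  "\<forall>\<^sub>F \<tau> in at_cusp. u \<tau> * r \<tau> * (1 + r (2 * \<tau>) ^ 2) = 2 * r (2 * \<tau>)"
proof -
  have "pi / 3 + pi / 3 = 2 * (pi / 3)" "pi / 3 - pi / 3 = 0" by simp_all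
  then show ?thesis
    using eventually_theta_quot_addition[of "pi / 3" "pi / 3"]
    by (simp only: theta_quot_2pi_third) (simp add: power2_eq_square mult_ac)
qed

text \<open>
  The spurious factor u + r is excluded by leading terms: u and r behave like twice the fourth root of the nome
  and once the fourth root of the nome.
\<close>

lemma eventually_curve:
  "\<forall>\<^sub>F \<tau> in at_cusp. u \<tau> * (1 - r \<tau> ^ 4) = 2 * r \<tau> * (1 - u \<tau> ^ 2 * r \<tau> ^ 2)"
proof -
  have "((\<lambda>\<tau>. u \<tau> / nome4 \<tau> + r \<tau> / nome4 \<tau>) \<longlongrightarrow> 2 + 1) at_cusp"
    by (intro tendsto_add theta_quot_0_tendsto theta_quot_pi_third_tendsto)
  then have "\<forall>\<^sub>F \<tau> in at_cusp. u \<tau> / nome4 \<tau> + r \<tau> / nome4 \<tau> \<noteq> 0"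
    by (rule tendsto_imp_eventually_ne) simp
  then have "\<forall>\<^sub>F \<tau> in at_cusp. u \<tau> + r \<tau> \<noteq> 0"
    by eventually_elim (auto simp: add_divide_distrib[symmetric])
  then have "\<forall>\<^sub>F \<tau> in at_cusp. u (2 * \<tau>) + r (2 * \<tau>) \<noteq> 0"
    by (subst eventually_at_cusp_double)
  with eventually_u_double eventually_r_double eventually_ur_double
  have "\<forall>\<^sub>F \<tau> in at_cusp. u (2 * \<tau>) * (1 - r (2 * \<tau>) ^ 4) =
      2 * r (2 * \<tau>) * (1 - u (2 * \<tau>) ^ 2 * r (2 * \<tau>) ^ 2)"
    by eventually_elim (rule doubling_imp_curve)
  then show ?thesis
    by (subst (asm) eventually_at_cusp_double)
qed

section \<open>Degree three relations by descent\<close>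

text \<open>
  The descent principle: iterating the inequality moves the argument to the cusp, where f vanishes.
\<close>

lemma eventually_zero_by_doubling:
  fixes f :: "complex \<Rightarrow> complex"
  assumes lim: "(f \<longlongrightarrow> 0) at_cusp" and le: "\<forall>\<^sub>F \<tau> in at_cusp. norm (f \<tau>) \<le> norm (f (2 * \<tau>))"
  shows "\<forall>\<^sub>F \<tau> in at_cusp. f \<tau> = 0"
proof -
  obtain c where c: "\<And>\<tau>. Im \<tau> \<ge> c \<Longrightarrow> norm (f \<tau>) \<le> norm (f (2 * \<tau>))"
    using le by (auto simp: eventually_at_cusp)
  have "f \<tau> = 0" if \<tau>: "Im \<tau> \<ge> max c 1" for \<tau>
  proof -
    have Im_ge: "Im \<tau> \<le> Im (2 ^ k * \<tau>)" for k :: nat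
    proof (induction k)
      case (Suc k)
      have "Im (2 ^ Suc k * \<tau>) = 2 * Im (2 ^ k * \<tau>)" by (simp add: mult.assoc)
      then show ?case using Suc \<tau> by linarith
    qed simp
    have le_k: "norm (f \<tau>) \<le> norm (f (2 ^ k * \<tau>))" for k :: nat
    proof (induction k)
      case (Suc k)
      have "norm (f (2 ^ k * \<tau>)) \<le> norm (f (2 * (2 ^ k * \<tau>)))"
        using Im_ge[of k] \<tau> by (intro c) linarith
      with Suc show ?case by (simp add: mult.assoc)
    qed simp
    have "filterlim (\<lambda>k::nat. 2 ^ k * Im \<tau>) at_top sequentially"
    proof (rule filterlim_at_top_mono[OF filterlim_real_sequentially], intro always_eventually allI)
      fix k :: nat
      have "real k \<le> 2 ^ k * 1"
        using of_nat_less_two_power[of k, where ?'a = real] by simp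
      also have "\<dots> \<le> 2 ^ k * Im \<tau>"
        using \<tau> by (intro mult_left_mono) auto
      finally show "real k \<le> 2 ^ k * Im \<tau>" .
    qed
    moreover have "Im (2 ^ k * \<tau>) = 2 ^ k * Im \<tau>" for k :: nat
      by (induction k) (simp_all add: mult.assoc)
    ultimately have "filterlim (\<lambda>k::nat. 2 ^ k * \<tau>) at_cusp sequentially"
      by (simp add: at_cusp_def filterlim_filtercomap_iff o_def)
    then have "(\<lambda>k. f (2 ^ k * \<tau>)) \<longlonglongrightarrow> 0"
      by (rule filterlim_compose[OF lim])
    then have "(\<lambda>k. norm (f (2 ^ k * \<tau>))) \<longlonglongrightarrow> 0"
      by (rule tendsto_norm_zero)
    then have "norm (f \<tau>) \<le> 0"
      by (rule tendsto_lowerbound) (use le_k in auto)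
    then show "f \<tau> = 0" by simp
  qed
  then show ?thesis
    unfolding eventually_at_cusp by blast
qed

lemma eventually_ne_of_tendsto_1:
  fixes f :: "complex \<Rightarrow> complex"
  assumes "(f \<longlongrightarrow> 1) at_cusp"
  shows "\<forall>\<^sub>F \<tau> in at_cusp. f \<tau> \<noteq> 0"
  by (rule tendsto_imp_eventually_ne[OF assms]) simp

lemma tendsto_double: "(f \<longlongrightarrow> l) at_cusp \<Longrightarrow> ((\<lambda>\<tau>. f (2 * \<tau>)) \<longlongrightarrow> l) at_cusp"
  and tendsto_triple: "(f \<longlongrightarrow> l) at_cusp \<Longrightarrow> ((\<lambda>\<tau>. f (3 * \<tau>)) \<longlongrightarrow> l) at_cusp"
  by (rule filterlim_compose[OF _ filterlim_at_cusp_numeral], assumption)+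

lemma eventually_triple: "eventually P at_cusp \<Longrightarrow> eventually (\<lambda>\<tau>. P (3 * \<tau>)) at_cusp"
  using eventually_at_cusp_scale[of 3 P] by simp

lemmas theta_quot_double_tendsto = tendsto_double[OF theta_quot_tendsto]

text \<open>
  Both v = u(3\<tau>) and V = u r^2 satisfy X(\<tau>)^2 (1 + X(2\<tau>)^2) = 2 X(2\<tau>) and
  both behave like twice the third power of the fourth root of the nome.  Subtracting the two relations expresses
  v - V at \<tau> through v - V at 2\<tau>; measured in units of that third power, the factor tends to 1/2, so the
  descent principle applies.
\<close>

lemma eventually_u_triple: "\<forall>\<^sub>F \<tau> in at_cusp. u (3 * \<tau>) = u \<tau> * r \<tau> ^ 2"
proof -
  define v V where "v = (\<lambda>\<tau>. u (3 * \<tau>))" and "V = (\<lambda>\<tau>. u \<tau> * r \<tau> ^ 2)"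
  have V_eq: "V \<tau> / nome4 \<tau> ^ 3 = u \<tau> / nome4 \<tau> * (r \<tau> / nome4 \<tau>) ^ 2" for \<tau>
    by (simp add: V_def power2_eq_square power3_eq_cube)
  have V_lim: "((\<lambda>\<tau>. V \<tau> / nome4 \<tau> ^ 3) \<longlongrightarrow> 2) at_cusp"
    unfolding V_eq
    using tendsto_mult[OF theta_quot_0_tendsto tendsto_power[OF theta_quot_pi_third_tendsto, of 2]] by simp
  have v_lim: "((\<lambda>\<tau>. v \<tau> / nome4 \<tau> ^ 3) \<longlongrightarrow> 2) at_cusp"
    using tendsto_triple[OF theta_quot_0_tendsto] nome4_scale[of 3] by (simp add: v_def)
  have v0: "(v \<longlongrightarrow> 0) at_cusp"
    unfolding v_def by (rule tendsto_triple) (rule theta_quot_tendsto)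
  have V0: "(V \<longlongrightarrow> 0) at_cusp"
    unfolding V_def by (auto intro!: tendsto_eq_intros theta_quot_tendsto)
  \<comment> \<open>the difference in its natural scale; e \<tau> * g \<tau> = e (2 * \<tau>) * h \<tau> with g \<longlongrightarrow> 4 and h \<longlongrightarrow> 2\<close>
  define e where "e = (\<lambda>\<tau>. (v \<tau> - V \<tau>) / nome4 \<tau> ^ 3)"
  define g where "g = (\<lambda>\<tau>. (v \<tau> + V \<tau>) / nome4 \<tau> ^ 3 * ((1 + v (2 * \<tau>) ^ 2) * (1 + V (2 * \<tau>) ^ 2)))"
  define h where "h = (\<lambda>\<tau>. 2 * (1 - v (2 * \<tau>) * V (2 * \<tau>)))"
  have "(e \<longlongrightarrow> 0) at_cusp"
    using tendsto_diff[OF v_lim V_lim] by (simp add: e_def diff_divide_distrib)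
  moreover have "\<forall>\<^sub>F \<tau> in at_cusp. norm (e \<tau>) \<le> norm (e (2 * \<tau>))"
  proof -
    have "((\<lambda>\<tau>. (v \<tau> / nome4 \<tau> ^ 3 + V \<tau> / nome4 \<tau> ^ 3) * ((1 + v (2 * \<tau>) ^ 2) * (1 + V (2 * \<tau>) ^ 2))) \<longlongrightarrow>
        (2 + 2) * ((1 + 0 ^ 2) * (1 + 0 ^ 2))) at_cusp"
      by (intro tendsto_intros v_lim V_lim tendsto_double[OF v0] tendsto_double[OF V0])
    then have g: "(g \<longlongrightarrow> 4) at_cusp"
      by (simp add: g_def add_divide_distrib)
    have "(h \<longlongrightarrow> 2 * (1 - 0 * 0)) at_cusp"
      unfolding h_def by (intro tendsto_intros tendsto_double[OF v0] tendsto_double[OF V0])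
    then have h: "(h \<longlongrightarrow> 2) at_cusp" by simp
    \<comment> \<open>3 separates the two limits\<close>
    have ev_g: "\<forall>\<^sub>F \<tau> in at_cusp. norm (g \<tau>) > 3"
      using order_tendstoD(1)[OF tendsto_norm[OF g], of 3] by simp
    have ev_h: "\<forall>\<^sub>F \<tau> in at_cusp. norm (h \<tau>) < 3"
      using order_tendstoD(2)[OF tendsto_norm[OF h], of 3] by simp
    have nz: "\<forall>\<^sub>F \<tau> in at_cusp. 1 + u (2 * \<tau>) ^ 2 \<noteq> 0"
      by (rule eventually_ne_of_tendsto_1) (auto intro!: tendsto_eq_intros theta_quot_double_tendsto)
    have nz': "\<forall>\<^sub>F \<tau> in at_cusp. 1 - u (2 * \<tau>) * r (2 * \<tau>) \<noteq> 0"
      by (rule eventually_ne_of_tendsto_1) (auto intro!: tendsto_eq_intros theta_quot_double_tendsto)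
    show ?thesis
      using ev_g ev_h nz nz' eventually_u_double eventually_r_double
        eventually_triple[OF eventually_u_double]
        eventually_at_cusp_double[THEN iffD2, OF eventually_curve]
    proof eventually_elim
      case (elim \<tau>)
      have "V \<tau> ^ 2 * (1 + V (2 * \<tau>) ^ 2) = 2 * V (2 * \<tau>)"
        unfolding V_def using elim(5,6,8,3,4) by (rule curve_imp_triple_doubling)
      moreover have "v \<tau> ^ 2 * (1 + v (2 * \<tau>) ^ 2) = 2 * v (2 * \<tau>)"
        using elim(7) by (simp add: v_def mult_ac)
      ultimately have "(v \<tau> - V \<tau>) * ((v \<tau> + V \<tau>) * ((1 + v (2 * \<tau>) ^ 2) * (1 + V (2 * \<tau>) ^ 2))) =
          (v (2 * \<tau>) - V (2 * \<tau>)) * h \<tau>"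
        unfolding h_def by algebra
      then have "e \<tau> * g \<tau> = (v (2 * \<tau>) - V (2 * \<tau>)) * h \<tau> / (nome4 \<tau> ^ 3 * nome4 \<tau> ^ 3)"
        by (simp add: e_def g_def)
      also have "nome4 \<tau> ^ 3 * nome4 \<tau> ^ 3 = nome4 (2 * \<tau>) ^ 3"
        using nome4_scale[of 2 \<tau>] by (simp add: power_add[symmetric] power_mult[symmetric])
      finally have "e \<tau> * g \<tau> = e (2 * \<tau>) * h \<tau>"
        by (simp add: e_def)
      then have "norm (e \<tau>) * norm (g \<tau>) = norm (e (2 * \<tau>)) * norm (h \<tau>)"
        by (simp only: norm_mult[symmetric])
      moreover have "norm (e \<tau>) * 3 \<le> norm (e \<tau>) * norm (g \<tau>)"
        "norm (e (2 * \<tau>)) * norm (h \<tau>) \<le> norm (e (2 * \<tau>)) * 3"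
        using elim(1,2) by (intro mult_left_mono; simp)+
      ultimately show ?case by linarith
    qed
  qed
  ultimately have "\<forall>\<^sub>F \<tau> in at_cusp. e \<tau> = 0"
    by (rule eventually_zero_by_doubling)
  then show ?thesis
    by eventually_elim (simp add: e_def v_def V_def)
qed

text \<open>
  The quotient of the two sides is invariant under \<tau> \<mapsto> 2\<tau> and tends to 1, hence it is 1.  The invariance
  combines the addition formula at the origin, for \<tau> and for 3\<tau>, with the corresponding relation on the curve.
\<close>

lemma eventually_multiplier:
  "\<forall>\<^sub>F \<tau> in at_cusp. theta3 0 \<tau> ^ 2 = theta3 0 (3 * \<tau>) ^ 2 * (1 + 2 * (u \<tau> * r \<tau> ^ 3))"
proof -
  define m where "m = (\<lambda>\<tau>. theta3 0 \<tau> ^ 2 / theta3 0 (3 * \<tau>) ^ 2)"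
  define p where "p = (\<lambda>\<tau>. 1 + 2 * (u \<tau> * r \<tau> ^ 3))"
  have theta3_lim: "(theta3 0 \<longlongrightarrow> 1) at_cusp"
    using theta3_tendsto[of 0] by simp
  have p_lim: "(p \<longlongrightarrow> 1) at_cusp"
    unfolding p_def by (auto intro!: tendsto_eq_intros theta_quot_tendsto)
  have p_nz: "\<forall>\<^sub>F \<tau> in at_cusp. p \<tau> \<noteq> 0"
    by (rule eventually_ne_of_tendsto_1[OF p_lim])
  have theta3_nz: "\<forall>\<^sub>F \<tau> in at_cusp. theta3 0 \<tau> \<noteq> 0"
    by (rule eventually_ne_of_tendsto_1[OF theta3_lim])
  have theta3_double: "\<forall>\<^sub>F \<tau> in at_cusp. theta3 0 \<tau> ^ 2 = theta3 0 (2 * \<tau>) ^ 2 * (1 + u (2 * \<tau>) ^ 2)"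
    using eventually_at_cusp_Im_ge[of 1] theta3_nz[THEN eventually_at_cusp_double[THEN iffD2]]
  proof eventually_elim
    case (elim \<tau>)
    then show ?case
      using theta3_addition[of \<tau> 0 0] by (simp add: theta_quot_def power2_eq_square field_simps)
  qed
  have "((\<lambda>\<tau>. m \<tau> / p \<tau> - 1) \<longlongrightarrow> 1 ^ 2 / 1 ^ 2 / 1 - 1) at_cusp"
    unfolding m_def by (intro tendsto_intros theta3_lim p_lim tendsto_triple[OF theta3_lim]) auto
  then have "((\<lambda>\<tau>. m \<tau> / p \<tau> - 1) \<longlongrightarrow> 0) at_cusp"
    by simp
  moreover have "\<forall>\<^sub>F \<tau> in at_cusp. norm (m \<tau> / p \<tau> - 1) \<le> norm (m (2 * \<tau>) / p (2 * \<tau>) - 1)"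
  proof -
    have nz1: "\<forall>\<^sub>F \<tau> in at_cusp. 1 + r (2 * \<tau>) ^ 2 \<noteq> 0"
      by (rule eventually_ne_of_tendsto_1) (auto intro!: tendsto_eq_intros theta_quot_double_tendsto)
    have nz2: "\<forall>\<^sub>F \<tau> in at_cusp. 1 - u (2 * \<tau>) * r (2 * \<tau>) \<noteq> 0"
      by (rule eventually_ne_of_tendsto_1) (auto intro!: tendsto_eq_intros theta_quot_double_tendsto)
    have nz3: "\<forall>\<^sub>F \<tau> in at_cusp. 1 + u \<tau> ^ 2 \<noteq> 0"
      by (rule eventually_ne_of_tendsto_1) (auto intro!: tendsto_eq_intros theta_quot_tendsto)
    have nz6: "\<forall>\<^sub>F \<tau> in at_cusp. 1 + u (2 * (3 * \<tau>)) ^ 2 \<noteq> 0"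
      using nz3 by (rule eventually_triple[OF eventually_at_cusp_double[THEN iffD2]])
    show ?thesis
      using nz1 nz2 eventually_at_cusp_double[THEN iffD2, OF nz3] nz6 p_nz p_nz[THEN eventually_at_cusp_double[THEN iffD2]]
        theta3_double eventually_triple[OF theta3_double]
        eventually_triple[OF theta3_nz[THEN eventually_at_cusp_double[THEN iffD2]]]
        eventually_r_double eventually_ur_double eventually_at_cusp_double[THEN iffD2, OF eventually_curve]
        eventually_at_cusp_double[THEN iffD2, OF eventually_u_triple]
    proof eventually_elim
      case (elim \<tau>)
      define U where "U = 1 + u (2 * \<tau>) ^ 2"
      define W where "W = 1 + (u (2 * \<tau>) * r (2 * \<tau>) ^ 2) ^ 2"
      have W: "W = 1 + u (2 * (3 * \<tau>)) ^ 2"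
        using elim(13) by (simp add: W_def mult_ac)
      have pW: "p \<tau> * W = p (2 * \<tau>) * U"
        unfolding p_def U_def W_def using elim(10-12,1,2) by (rule curve_imp_multiplier_doubling)
      have "m \<tau> = m (2 * \<tau>) * U / W"
        using elim(7,8) unfolding m_def U_def W by (simp add: mult_ac)
      moreover have "W \<noteq> 0" "U \<noteq> 0" using elim(3,4) by (auto simp: W U_def)
      ultimately have "m \<tau> / p \<tau> = m (2 * \<tau>) * U / (p \<tau> * W)"
        by (simp add: mult_ac)
      also have "\<dots> = m (2 * \<tau>) / p (2 * \<tau>)"
        unfolding pW using \<open>U \<noteq> 0\<close> by simp
      finally show ?case by simp
    qed
  qed
  ultimately have "\<forall>\<^sub>F \<tau> in at_cusp. m \<tau> / p \<tau> - 1 = 0"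
    by (rule eventually_zero_by_doubling)
  then show ?thesis
    using p_nz eventually_triple[OF theta3_nz]
    by eventually_elim (simp add: m_def p_def field_simps)
qed

section \<open>The functions \<open>beta\<close>\<close>

lemma beta_eq_theta_quot: "beta k \<tau> = theta_quot (real k * pi / 12) \<tau> ^ 2"
  by (simp add: beta_def theta_quot_def power_divide)

lemma eventually_theta_quot_square:
  "\<forall>\<^sub>F \<tau> in at_cusp. theta_quot x \<tau> ^ 2 * (1 + theta_quot (2 * x) (2 * \<tau>) * u (2 * \<tau>)) =
    theta_quot (2 * x) (2 * \<tau>) + u (2 * \<tau>)"
  using eventually_theta_quot_addition[of x 0] by (simp add: power2_eq_square)

lemma theta_quot_pi_half: "theta_quot (pi / 2) \<tau> = 0"
  using theta_quot_pi_minus[of "pi / 2" \<tau>] by simp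

text \<open>
  The doubled points \<pi>/3 and 2\<pi>/3 have the quotients r(2\<tau>) and -r(2\<tau>).  So the squares at
  \<pi>/6, \<pi>/3 and 0 are all rational in u(2\<tau>) and r(2\<tau>), which can be eliminated.
\<close>

lemma eventually_theta_quot_pi_sixth:
  "\<forall>\<^sub>F \<tau> in at_cusp. theta_quot (pi / 6) \<tau> ^ 2 * (1 - u \<tau> ^ 2 * r \<tau> ^ 2) = u \<tau> ^ 2 - r \<tau> ^ 2"
proof -
  have nz1: "\<forall>\<^sub>F \<tau> in at_cusp. 1 + u (2 * \<tau>) ^ 2 \<noteq> 0"
    by (rule eventually_ne_of_tendsto_1) (auto intro!: tendsto_eq_intros theta_quot_double_tendsto)
  have nz2: "\<forall>\<^sub>F \<tau> in at_cusp. 1 - u (2 * \<tau>) * r (2 * \<tau>) \<noteq> 0"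
    by (rule eventually_ne_of_tendsto_1) (auto intro!: tendsto_eq_intros theta_quot_double_tendsto)
  have nz3: "\<forall>\<^sub>F \<tau> in at_cusp. 1 + u (2 * \<tau>) * r (2 * \<tau>) \<noteq> 0"
    by (rule eventually_ne_of_tendsto_1) (auto intro!: tendsto_eq_intros theta_quot_double_tendsto)
  show ?thesis
    using nz1 nz2 nz3 eventually_u_double eventually_r_double eventually_theta_quot_square[of "pi / 6"]
  proof eventually_elim
    case (elim \<tau>)
    define \<kappa> \<rho> R w s where "\<kappa> = u (2 * \<tau>)" "\<rho> = r (2 * \<tau>)" "R = theta_quot (pi / 6) \<tau> ^ 2"
      "w = u \<tau> ^ 2" "s = r \<tau> ^ 2"
    note defs = this
    have w: "w * (1 + \<kappa> ^ 2) = 2 * \<kappa>" and s: "s * (1 - \<kappa> * \<rho>) = \<kappa> - \<rho>" and R: "R * (1 + \<kappa> * \<rho>) = \<rho> + \<kappa>"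
      using elim(4-6) by (simp_all add: defs mult_ac)
    have "((1 + \<kappa> ^ 2) * (1 - \<kappa> * \<rho>) * (1 + \<kappa> * \<rho>)) * (R * (1 - w * s)) =
        ((1 + \<kappa> ^ 2) * (1 - \<kappa> * \<rho>) * (1 + \<kappa> * \<rho>)) * (w - s)"
      using w s R by algebra
    then show ?case
      using elim(1-3) by (simp add: defs)
  qed
qed

text \<open>
  The points 1, 3, 5 times \<pi>/12 double to \<pi>/6, \<pi>/2, 5\<pi>/6; the quotient vanishes at the second, and
  the third is the negative of the first.  So \<beta>_1 and \<beta>_5 are exchanged by a change of sign, and
  their sum and product only involve the square of the quotient at \<pi>/6.
\<close>

lemma eventually_beta:
  "\<forall>\<^sub>F \<tau> in at_cusp. beta 3 \<tau> = u (2 * \<tau>) \<and>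
     beta 1 \<tau> + beta 5 \<tau> = 2 * u (2 * \<tau>) * (1 + r (2 * \<tau>) ^ 2) / (1 + u (2 * \<tau>) ^ 2) \<and>
     beta 1 \<tau> * beta 5 \<tau> = r (2 * \<tau>) ^ 2"
proof -
  have three: "\<forall>\<^sub>F \<tau> in at_cusp. beta 3 \<tau> = u (2 * \<tau>)"
    using eventually_theta_quot_square[of "pi / 4"]
    by eventually_elim (simp add: beta_eq_theta_quot theta_quot_pi_half)
  have one: "\<forall>\<^sub>F \<tau> in at_cusp. beta 1 \<tau> * (1 + theta_quot (pi / 6) (2 * \<tau>) * u (2 * \<tau>)) =
      theta_quot (pi / 6) (2 * \<tau>) + u (2 * \<tau>)"
    using eventually_theta_quot_square[of "pi / 12"] by (simp add: beta_eq_theta_quot)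
  have "pi - pi / 6 = 2 * (5 * pi / 12)" by simp
  then have five_sixths: "theta_quot (2 * (5 * pi / 12)) \<tau> = - theta_quot (pi / 6) \<tau>" for \<tau>
    using theta_quot_pi_minus[of "pi / 6" \<tau>] by simp
  have five: "\<forall>\<^sub>F \<tau> in at_cusp. beta 5 \<tau> * (1 - theta_quot (pi / 6) (2 * \<tau>) * u (2 * \<tau>)) =
      u (2 * \<tau>) - theta_quot (pi / 6) (2 * \<tau>)"
    using eventually_theta_quot_square[of "5 * pi / 12"] unfolding five_sixths
    by (simp add: beta_eq_theta_quot)
  have nz1: "\<forall>\<^sub>F \<tau> in at_cusp. 1 + theta_quot (pi / 6) (2 * \<tau>) * u (2 * \<tau>) \<noteq> 0"
    by (rule eventually_ne_of_tendsto_1) (auto intro!: tendsto_eq_intros theta_quot_double_tendsto)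
  have nz2: "\<forall>\<^sub>F \<tau> in at_cusp. 1 - theta_quot (pi / 6) (2 * \<tau>) * u (2 * \<tau>) \<noteq> 0"
    by (rule eventually_ne_of_tendsto_1) (auto intro!: tendsto_eq_intros theta_quot_double_tendsto)
  have nz3: "\<forall>\<^sub>F \<tau> in at_cusp. 1 - u (2 * \<tau>) ^ 4 \<noteq> 0"
    by (rule eventually_ne_of_tendsto_1) (auto intro!: tendsto_eq_intros theta_quot_double_tendsto)
  have nz4: "\<forall>\<^sub>F \<tau> in at_cusp. 1 - u (2 * \<tau>) ^ 2 * r (2 * \<tau>) ^ 2 \<noteq> 0"
    by (rule eventually_ne_of_tendsto_1) (auto intro!: tendsto_eq_intros theta_quot_double_tendsto)
  show ?thesis
    using nz1 nz2 nz3 nz4 one three five eventually_at_cusp_double[THEN iffD2, OF eventually_theta_quot_pi_sixth]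
  proof eventually_elim
    case (elim \<tau>)
    define v s k where "v = u (2 * \<tau>)" "s = r (2 * \<tau>) ^ 2" "k = theta_quot (pi / 6) (2 * \<tau>)"
    note defs = this
    have b1: "beta 1 \<tau> * (1 + k * v) = k + v" and b5: "beta 5 \<tau> * (1 - k * v) = v - k"
      and k: "k ^ 2 * (1 - v ^ 2 * s) = v ^ 2 - s"
      using elim(5,7,8) by (simp_all add: defs)
    have nz: "1 + k * v \<noteq> 0" "1 - k * v \<noteq> 0" "1 - v ^ 4 \<noteq> 0" "1 - v ^ 2 * s \<noteq> 0"
      using elim(1-4) by (simp_all add: defs)
    have "1 - v ^ 4 = (1 - v ^ 2) * (1 + v ^ 2)" by algebra
    with nz(3) have nz': "1 - v ^ 2 \<noteq> 0" "1 + v ^ 2 \<noteq> 0" by auto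
    have "((1 + k * v) * (1 - k * v) * (1 - v ^ 2 * s)) * (beta 1 \<tau> * beta 5 \<tau>) =
        ((1 + k * v) * (1 - k * v) * (1 - v ^ 2 * s)) * s"
      using b1 b5 k by algebra
    then have "beta 1 \<tau> * beta 5 \<tau> = s"
      using nz by simp
    moreover have "((1 + k * v) * (1 - k * v) * (1 - v ^ 2 * s)) * ((beta 1 \<tau> + beta 5 \<tau>) * (1 + v ^ 2)) =
        ((1 + k * v) * (1 - k * v) * (1 - v ^ 2 * s)) * (2 * v * (1 + s))"
      using b1 b5 k by algebra
    then have "(beta 1 \<tau> + beta 5 \<tau>) * (1 + v ^ 2) = 2 * v * (1 + s)"
      using nz by simp
    then have "beta 1 \<tau> + beta 5 \<tau> = 2 * v * (1 + s) / (1 + v ^ 2)"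
      using nz' by (simp add: eq_divide_eq)
    ultimately show ?case
      using elim(6) by (simp add: defs)
  qed
qed

section \<open>The identities near the cusp\<close>

text \<open>
  Here c and a stand for \<theta>3(0,6\<tau>) and \<theta>2(0,6\<tau>), and X, Y for \<theta>2(0,\<tau>)^2 and
  \<theta>3(0,\<tau>)^2.  Everything is a multiple of a power of c, and the powers of c cancel.
\<close>

lemma rational_forms:
  fixes u s w D c a X Y :: complex
  assumes w: "w = u\<^sup>2" and X: "X = 2 * u * (c\<^sup>2 * D)" and Y: "Y = c\<^sup>2 * D * (1 + w)" and a: "a = u * s * c"
    and nz: "u \<noteq> 0" "c \<noteq> 0" "D \<noteq> 0" "1 + w \<noteq> 0" "(1 + w) * D\<^sup>2 - 9 * s * (1 + w * s\<^sup>2) \<noteq> 0"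
  shows "6 * a * (a\<^sup>2 + c\<^sup>2) / (X * Y) * ((3 * X * Y * a - c * (X\<^sup>2 + Y\<^sup>2 + 45 * a ^ 4 - 9 * c ^ 4))
      / (X * Y - 18 * a * c * (a\<^sup>2 + c\<^sup>2))) =
    3 * s * (1 + w * s\<^sup>2) * (D\<^sup>2 * (6 * w * s * (1 + w) - (1 + 6 * w + w\<^sup>2)) - 9 * (5 * w\<^sup>2 * s ^ 4 - 1)) /
     (2 * u * (1 + w) * (((1 + w) * D\<^sup>2 - 9 * s * (1 + w * s\<^sup>2)) * D\<^sup>2))" (is ?thesis1)
  and "6 * a * (a\<^sup>2 + c\<^sup>2) / (X * Y) * ((3 * X * Y * c - a * (X\<^sup>2 + Y\<^sup>2 - 9 * a ^ 4 + 45 * c ^ 4))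
      / (X * Y - 18 * a * c * (a\<^sup>2 + c\<^sup>2))) =
    3 * s * (1 + w * s\<^sup>2) * (D\<^sup>2 * (6 * (1 + w) - s * (1 + 6 * w + w\<^sup>2)) - 9 * s * (5 - w\<^sup>2 * s ^ 4)) /
     (2 * (1 + w) * (((1 + w) * D\<^sup>2 - 9 * s * (1 + w * s\<^sup>2)) * D\<^sup>2))" (is ?thesis2)
proof -
  define E where "E = (1 + w) * D\<^sup>2 - 9 * s * (1 + w * s\<^sup>2)"
  have E: "E \<noteq> 0" using nz by (simp add: E_def)
  have den: "X * Y - 18 * a * c * (a\<^sup>2 + c\<^sup>2) = 2 * u * c ^ 4 * E"
    unfolding E_def X Y a w by algebra
  have XY: "X * Y = 2 * u * c ^ 4 * D\<^sup>2 * (1 + w)"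
    unfolding X Y w by algebra
  have pre: "6 * a * (a\<^sup>2 + c\<^sup>2) = 6 * u * s * c ^ 3 * (1 + w * s\<^sup>2)"
    unfolding a w by algebra
  have num1: "3 * X * Y * a - c * (X\<^sup>2 + Y\<^sup>2 + 45 * a ^ 4 - 9 * c ^ 4) =
      c ^ 5 * (D\<^sup>2 * (6 * w * s * (1 + w) - (1 + 6 * w + w\<^sup>2)) - 9 * (5 * w\<^sup>2 * s ^ 4 - 1))" (is "_ = _ * ?N1")
    unfolding X Y a w by algebra
  have num2: "3 * X * Y * c - a * (X\<^sup>2 + Y\<^sup>2 - 9 * a ^ 4 + 45 * c ^ 4) =
      u * c ^ 5 * (D\<^sup>2 * (6 * (1 + w) - s * (1 + 6 * w + w\<^sup>2)) - 9 * s * (5 - w\<^sup>2 * s ^ 4))" (is "_ = _ * ?N2")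
    unfolding X Y a w by algebra
  have "6 * u * s * c ^ 3 * F / (2 * u * c ^ 4 * D\<^sup>2 * G) * (c ^ 5 * N / (2 * u * c ^ 4 * E)) =
      3 * s * F * N / (2 * u * G * (E * D\<^sup>2))" if "G \<noteq> 0" for F G N
    using nz(1-3) E that by (simp add: divide_simps eval_nat_numeral)
  from this[OF nz(4)] show ?thesis1
    unfolding den unfolding pre num1 XY E_def[symmetric] .
  have "6 * u * s * c ^ 3 * F / (2 * u * c ^ 4 * D\<^sup>2 * G) * (u * c ^ 5 * N / (2 * u * c ^ 4 * E)) =
      3 * s * F * N / (2 * G * (E * D\<^sup>2))" if "G \<noteq> 0" for F G N
    using nz(1-3) E that by (simp add: divide_simps eval_nat_numeral)
  from this[OF nz(4)] show ?thesis2
    unfolding den unfolding pre num2 XY E_def[symmetric] .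
qed

lemma eventually_symmetric_functions:
  "\<forall>\<^sub>F \<tau> in at_cusp.
     beta 1 \<tau> + beta 3 \<tau> + beta 5 \<tau> = 6 * theta2 0 (6*\<tau>) * (theta2 0 (6*\<tau>) ^ 2 + theta3 0 (6*\<tau>) ^ 2)
            / (theta2 0 \<tau> ^ 2 * theta3 0 \<tau> ^ 2)
          * ((3 * theta2 0 \<tau> ^ 2 * theta3 0 \<tau> ^ 2 * theta2 0 (6*\<tau>)
              - theta3 0 (6*\<tau>) * (theta2 0 \<tau> ^ 4 + theta3 0 \<tau> ^ 4
                  + 45 * theta2 0 (6*\<tau>) ^ 4 - 9 * theta3 0 (6*\<tau>) ^ 4))
            / (theta2 0 \<tau> ^ 2 * theta3 0 \<tau> ^ 2
              - 18 * theta2 0 (6*\<tau>) * theta3 0 (6*\<tau>)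
                * (theta2 0 (6*\<tau>) ^ 2 + theta3 0 (6*\<tau>) ^ 2))) \<and>
     beta 1 \<tau> * beta 3 \<tau> + beta 1 \<tau> * beta 5 \<tau> + beta 3 \<tau> * beta 5 \<tau> =
        (6 * theta2 0 (6*\<tau>) * (theta2 0 (6*\<tau>) ^ 2 + theta3 0 (6*\<tau>) ^ 2))
            / (theta2 0 \<tau> ^ 2 * theta3 0 \<tau> ^ 2)
          * ((3 * theta2 0 \<tau> ^ 2 * theta3 0 \<tau> ^ 2 * theta3 0 (6*\<tau>)
              - theta2 0 (6*\<tau>) * (theta2 0 \<tau> ^ 4 + theta3 0 \<tau> ^ 4
                  - 9 * theta2 0 (6*\<tau>) ^ 4 + 45 * theta3 0 (6*\<tau>) ^ 4))
            / (theta2 0 \<tau> ^ 2 * theta3 0 \<tau> ^ 2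
              - 18 * theta2 0 (6*\<tau>) * theta3 0 (6*\<tau>)
                * (theta2 0 (6*\<tau>) ^ 2 + theta3 0 (6*\<tau>) ^ 2))) \<and>
     beta 1 \<tau> * beta 3 \<tau> * beta 5 \<tau> = theta2 0 (6*\<tau>) / theta3 0 (6*\<tau>)"
proof -
  have nz_of_nome: "\<forall>\<^sub>F \<tau> in at_cusp. f \<tau> \<noteq> 0"
    if "((\<lambda>\<tau>. f \<tau> / nome4 \<tau>) \<longlongrightarrow> l) at_cusp" "l \<noteq> 0" for f l
    using tendsto_imp_eventually_ne[OF that] by eventually_elim auto
  have "((\<lambda>\<tau>. (1 + u \<tau> ^ 2) * (1 + 2 * (u \<tau> * r \<tau> ^ 3))\<^sup>2 - 9 * r \<tau> ^ 2 * (1 + u \<tau> ^ 2 * (r \<tau> ^ 2)\<^sup>2)) \<longlongrightarrow> 1) at_cusp"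
    by (auto intro!: tendsto_eq_intros theta_quot_tendsto)
  then have nz1: "\<forall>\<^sub>F \<tau> in at_cusp. (1 + u \<tau> ^ 2) * (1 + 2 * (u \<tau> * r \<tau> ^ 3))\<^sup>2 - 9 * r \<tau> ^ 2 * (1 + u \<tau> ^ 2 * (r \<tau> ^ 2)\<^sup>2) \<noteq> 0"
    by (rule eventually_ne_of_tendsto_1)
  have nz2: "\<forall>\<^sub>F \<tau> in at_cusp. 1 + u \<tau> ^ 2 \<noteq> 0"
    by (rule eventually_ne_of_tendsto_1) (auto intro!: tendsto_eq_intros theta_quot_tendsto)
  have nz3: "\<forall>\<^sub>F \<tau> in at_cusp. 1 + 2 * (u \<tau> * r \<tau> ^ 3) \<noteq> 0"
    by (rule eventually_ne_of_tendsto_1) (auto intro!: tendsto_eq_intros theta_quot_tendsto)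
  have "((\<lambda>\<tau>. 2 + u \<tau> * r \<tau> ^ 3) \<longlongrightarrow> 2) at_cusp"
    by (auto intro!: tendsto_eq_intros theta_quot_tendsto)
  then have nz4: "\<forall>\<^sub>F \<tau> in at_cusp. 2 + u \<tau> * r \<tau> ^ 3 \<noteq> 0"
    by (rule tendsto_imp_eventually_ne) simp
  have nz5: "\<forall>\<^sub>F \<tau> in at_cusp. u \<tau> \<noteq> 0"
    by (rule nz_of_nome[OF theta_quot_0_tendsto]) simp
  have nz6: "\<forall>\<^sub>F \<tau> in at_cusp. r \<tau> \<noteq> 0"
    by (rule nz_of_nome[OF theta_quot_pi_third_tendsto]) simp
  have theta3_nz: "\<forall>\<^sub>F \<tau> in at_cusp. theta3 0 \<tau> \<noteq> 0"
    using eventually_theta3_nonzero[of 0] by simp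
  note base = nz1 nz2 nz3 nz4 nz5 nz6 theta3_nz eventually_triple[OF theta3_nz]
    eventually_curve eventually_u_triple eventually_multiplier
  show ?thesis
    using base[THEN eventually_at_cusp_double[THEN iffD2]] eventually_at_cusp_Im_ge[of 1] eventually_beta
  proof eventually_elim
    case (elim \<tau>)
    \<comment> \<open>the curve is used at 2\<tau>, so that its degree three translate is 6\<tau>\<close>
    define t v \<rho> where "t = 2 * \<tau>" "v = u t" "\<rho> = r t"
    note t_defs = this
    define p where "p = v * \<rho> ^ 3"
    define s where "s = \<rho> ^ 2"
    define w where "w = v ^ 2"
    define D where "D = 1 + 2 * p"
    define A where "A = theta3 0 t"
    define c where "c = theta3 0 (6 * \<tau>)"
    define a where "a = theta2 0 (6 * \<tau>)"
    define X where "X = theta2 0 \<tau> ^ 2"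
    define Y where "Y = theta3 0 \<tau> ^ 2"
    have t3: "3 * t = 6 * \<tau>" by (simp add: t_defs)
    have nz: "v \<noteq> 0" "\<rho> \<noteq> 0" "D \<noteq> 0" "2 + p \<noteq> 0" "1 + w \<noteq> 0" "(1 + w) * D\<^sup>2 - 9 * s * (1 + w * s\<^sup>2) \<noteq> 0"
      using elim(1-6) by (simp_all add: t_defs p_def s_def w_def D_def)
    have nz': "A \<noteq> 0" "c \<noteq> 0"
      using elim(7,8) by (simp_all add: A_def c_def t_defs)
    have curve: "v * (1 - \<rho> ^ 4) = 2 * \<rho> * (1 - v\<^sup>2 * \<rho>\<^sup>2)"
      using elim(9) by (simp add: t_defs)
    have a: "a = v * s * c"
      using elim(10) nz'(2) by (simp add: t_defs s_def a_def c_def theta_quot_def field_simps)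
    have A: "A\<^sup>2 = c\<^sup>2 * D"
      using elim(11) by (simp add: t_defs A_def c_def D_def p_def)
    have B: "theta2 0 t = v * A"
      using nz' by (simp add: t_defs A_def theta_quot_def)
    have "Im \<tau> > 0" using elim(12) by simp
    have X: "X = 2 * v * (c\<^sup>2 * D)"
      using theta2_addition[OF \<open>Im \<tau> > 0\<close>, of 0 0]
      unfolding A[symmetric] t_defs(1)[symmetric] by (simp add: X_def power2_eq_square B A_def[symmetric])
    have Y: "Y = c\<^sup>2 * D * (1 + w)"
      using theta3_addition[OF \<open>Im \<tau> > 0\<close>, of 0 0]
      unfolding A[symmetric] t_defs(1)[symmetric]
      by (simp add: Y_def w_def power2_eq_square B A_def[symmetric] algebra_simps)
    have pow4: "theta2 0 \<tau> ^ 4 = X\<^sup>2" "theta3 0 \<tau> ^ 4 = Y\<^sup>2"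
      by (simp_all add: X_def Y_def power_mult[symmetric])
    note forms = rational_forms[OF w_def X Y a nz(1) nz'(2) nz(3,5,6)]
    have b3: "beta 3 \<tau> = v" and b15: "beta 1 \<tau> + beta 5 \<tau> = 2 * v * (1 + s) / (1 + w)"
      and b1b5: "beta 1 \<tau> * beta 5 \<tau> = s"
      using elim(13) by (simp_all add: t_defs s_def w_def)
    define E where "E = ((1 + w) * D\<^sup>2 - 9 * s * (1 + w * s\<^sup>2)) * D\<^sup>2"
    have E: "E \<noteq> 0" using nz by (simp add: E_def)
    have "beta 1 \<tau> + beta 3 \<tau> + beta 5 \<tau> = v + 2 * v * (1 + s) / (1 + w)"
      using b3 b15 by (simp add: algebra_simps)
    also have "\<dots> = v * (3 + w + 2 * s) / (1 + w)"
      using nz(5) by (simp add: field_simps)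
    also have "\<dots> = 2 * w * (3 + w + 2 * s) * E / (2 * v * (1 + w) * E)"
      using nz(1,5) E by (simp add: w_def power2_eq_square)
    also have "2 * w * (3 + w + 2 * s) * E = 3 * s * (1 + w * s\<^sup>2) *
        (D\<^sup>2 * (6 * w * s * (1 + w) - (1 + 6 * w + w\<^sup>2)) - 9 * (5 * w\<^sup>2 * s ^ 4 - 1))"
      using curve_sum_identity[OF curve p_def s_def w_def D_def nz(1-4)] by (simp only: E_def mult.assoc)
    also have "\<dots> / (2 * v * (1 + w) * E) = 6 * a * (a\<^sup>2 + c\<^sup>2) / (X * Y) *
        ((3 * X * Y * a - c * (X\<^sup>2 + Y\<^sup>2 + 45 * a ^ 4 - 9 * c ^ 4)) / (X * Y - 18 * a * c * (a\<^sup>2 + c\<^sup>2)))"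
      unfolding E_def by (rule forms(1)[symmetric])
    finally have sum1: "beta 1 \<tau> + beta 3 \<tau> + beta 5 \<tau> = \<dots>" .
    have "beta 1 \<tau> * beta 3 \<tau> + beta 1 \<tau> * beta 5 \<tau> + beta 3 \<tau> * beta 5 \<tau> =
        s + v * (2 * v * (1 + s) / (1 + w))"
    proof -
      have "beta 1 \<tau> * beta 3 \<tau> + beta 1 \<tau> * beta 5 \<tau> + beta 3 \<tau> * beta 5 \<tau> =
          beta 1 \<tau> * beta 5 \<tau> + beta 3 \<tau> * (beta 1 \<tau> + beta 5 \<tau>)"
        by algebra
      then show ?thesis by (simp only: b3 b15 b1b5)
    qed
    also have "\<dots> = (s + 2 * w + 3 * w * s) / (1 + w)"
      using nz(5) by (simp add: w_def field_simps power2_eq_square)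
    also have "\<dots> = 2 * (s + 2 * w + 3 * w * s) * E / (2 * (1 + w) * E)"
    proof -
      have "x / y = 2 * x * E / (2 * y * E)" for x y :: complex
        using E by simp
      then show ?thesis .
    qed
    also have "2 * (s + 2 * w + 3 * w * s) * E = 3 * s * (1 + w * s\<^sup>2) *
        (D\<^sup>2 * (6 * (1 + w) - s * (1 + 6 * w + w\<^sup>2)) - 9 * s * (5 - w\<^sup>2 * s ^ 4))"
      using curve_pair_sum_identity[OF curve p_def s_def w_def D_def nz(1-4)] by (simp only: E_def mult.assoc)
    also have "\<dots> / (2 * (1 + w) * E) = 6 * a * (a\<^sup>2 + c\<^sup>2) / (X * Y) *
        ((3 * X * Y * c - a * (X\<^sup>2 + Y\<^sup>2 - 9 * a ^ 4 + 45 * c ^ 4)) / (X * Y - 18 * a * c * (a\<^sup>2 + c\<^sup>2)))"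
      unfolding E_def by (rule forms(2)[symmetric])
    finally have sum2: "beta 1 \<tau> * beta 3 \<tau> + beta 1 \<tau> * beta 5 \<tau> + beta 3 \<tau> * beta 5 \<tau> = \<dots>" .
    have "beta 1 \<tau> * beta 3 \<tau> * beta 5 \<tau> = a / c"
      using b3 nz'(2) unfolding a by (simp add: b1b5[symmetric])
    then show ?case
      using sum1 sum2 unfolding pow4 X_def[symmetric] Y_def[symmetric] a_def[symmetric] c_def[symmetric]
      by (simp only: mult.assoc simp_thms)
  qed
qed

section \<open>Continuation to the upper half plane\<close>

text \<open>
  A meromorphic function on a connected domain that vanishes on a half plane vanishes off a sparse set.  In this
  way zeros of denominators have to be controlled near the cusp only.
\<close>

lemma meromorphic_identity_from_cusp:
  assumes f: "f meromorphic_on upper_half_plane" and g: "g meromorphic_on upper_half_plane"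
    and eq: "\<forall>\<^sub>F \<tau> in at_cusp. f \<tau> = g \<tau>"
  shows "meromorphic_identity_on upper_half_plane f g"
proof -
  have op: "open upper_half_plane"
    unfolding upper_half_plane_def by (rule open_halfspace_Im_gt)
  have conn: "connected upper_half_plane"
    unfolding upper_half_plane_def by (intro convex_connected convex_halfspace_Im_gt)
  have "(\<lambda>\<tau>. f \<tau> - g \<tau>) meromorphic_on upper_half_plane"
    by (intro meromorphic_intros f g)
  from meromorphic_imp_constant_or_avoid[OF this op conn, of 0]
  have "\<forall>\<^sub>\<approx>\<tau>\<in>upper_half_plane. f \<tau> - g \<tau> = 0"
  proof
    assume avoid: "\<forall>\<^sub>\<approx>\<tau>\<in>upper_half_plane. f \<tau> - g \<tau> \<noteq> 0"
    obtain c where c: "\<And>\<tau>. Im \<tau> \<ge> c \<Longrightarrow> f \<tau> = g \<tau>"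
      using eq by (auto simp: eventually_at_cusp)
    define z where "z = Complex 0 (max c 0 + 1)"
    have "z \<in> upper_half_plane" by (simp add: z_def upper_half_plane_def)
    then have "\<forall>\<^sub>F \<tau> in at z. f \<tau> \<noteq> g \<tau>"
      using avoid op by (auto simp: eventually_cosparse_open_eq)
    moreover have "\<forall>\<^sub>F \<tau> in at z. \<tau> \<in> {\<tau>. Im \<tau> > c}"
      by (rule eventually_at_in_open') (auto simp: open_halfspace_Im_gt z_def)
    ultimately have "\<forall>\<^sub>F \<tau> in at z. False"
      by eventually_elim (use c in force)
    then show ?thesis by simp
  qed
  then show ?thesis
    using f g by (simp add: meromorphic_identity_on_def)
qed

lemma meromorphic_theta_scale:
  assumes "f holomorphic_on {\<tau>. Im \<tau> > 0}" "c > 0"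
  shows "(\<lambda>\<tau>. f (of_real c * \<tau>)) meromorphic_on upper_half_plane"
proof -
  have "(\<lambda>\<tau>. f (of_real c * \<tau>)) holomorphic_on {\<tau>. Im \<tau> > 0}"
    by (rule holomorphic_on_compose_gen[of "\<lambda>\<tau>. of_real c * \<tau>" _ f, unfolded o_def, OF _ assms(1)])
       (use assms(2) in \<open>auto intro!: holomorphic_intros\<close>)
  then show ?thesis
    unfolding upper_half_plane_def
    by (intro analytic_on_imp_meromorphic_on) (simp add: analytic_on_open open_halfspace_Im_gt)
qed

lemma meromorphic_theta:
  "theta2 (of_real x) meromorphic_on upper_half_plane" "theta3 (of_real x) meromorphic_on upper_half_plane"
  using meromorphic_theta_scale[OF holomorphic_theta2, of 1 x] meromorphic_theta_scale[OF holomorphic_theta3, of 1 x]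
  by simp_all

lemma meromorphic_theta_zero:
  "theta2 0 meromorphic_on upper_half_plane" "theta3 0 meromorphic_on upper_half_plane"
  "(\<lambda>\<tau>. theta2 0 (6 * \<tau>)) meromorphic_on upper_half_plane" "(\<lambda>\<tau>. theta3 0 (6 * \<tau>)) meromorphic_on upper_half_plane"
  using meromorphic_theta[of 0] meromorphic_theta_scale[OF holomorphic_theta2, of 6 0]
    meromorphic_theta_scale[OF holomorphic_theta3, of 6 0]
  by simp_all

lemma meromorphic_beta: "beta k meromorphic_on upper_half_plane"
proof -
  have "beta k = (\<lambda>\<tau>. theta2 (of_real (real k * pi / 12)) \<tau> ^ 2 / theta3 (of_real (real k * pi / 12)) \<tau> ^ 2)"
    by (rule ext) (simp add: beta_def)
  then show ?thesis
    by (auto intro!: meromorphic_intros meromorphic_theta simp del: of_real_mult of_real_divide)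
qed

theorem mainTheorem9:
  shows "meromorphic_identity_on upper_half_plane
      (\<lambda>\<tau>. beta 1 \<tau> + beta 3 \<tau> + beta 5 \<tau>)
      (\<lambda>\<tau>. (6 * theta2 0 (6*\<tau>) * (theta2 0 (6*\<tau>) ^ 2 + theta3 0 (6*\<tau>) ^ 2))
            / (theta2 0 \<tau> ^ 2 * theta3 0 \<tau> ^ 2)
          * ((3 * theta2 0 \<tau> ^ 2 * theta3 0 \<tau> ^ 2 * theta2 0 (6*\<tau>)
              - theta3 0 (6*\<tau>) * (theta2 0 \<tau> ^ 4 + theta3 0 \<tau> ^ 4
                  + 45 * theta2 0 (6*\<tau>) ^ 4 - 9 * theta3 0 (6*\<tau>) ^ 4))
            / (theta2 0 \<tau> ^ 2 * theta3 0 \<tau> ^ 2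
              - 18 * theta2 0 (6*\<tau>) * theta3 0 (6*\<tau>)
                * (theta2 0 (6*\<tau>) ^ 2 + theta3 0 (6*\<tau>) ^ 2))))
    \<and> meromorphic_identity_on upper_half_plane
      (\<lambda>\<tau>. beta 1 \<tau> * beta 3 \<tau> + beta 1 \<tau> * beta 5 \<tau> + beta 3 \<tau> * beta 5 \<tau>)
      (\<lambda>\<tau>. (6 * theta2 0 (6*\<tau>) * (theta2 0 (6*\<tau>) ^ 2 + theta3 0 (6*\<tau>) ^ 2))
            / (theta2 0 \<tau> ^ 2 * theta3 0 \<tau> ^ 2)
          * ((3 * theta2 0 \<tau> ^ 2 * theta3 0 \<tau> ^ 2 * theta3 0 (6*\<tau>)
              - theta2 0 (6*\<tau>) * (theta2 0 \<tau> ^ 4 + theta3 0 \<tau> ^ 4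
                  - 9 * theta2 0 (6*\<tau>) ^ 4 + 45 * theta3 0 (6*\<tau>) ^ 4))
            / (theta2 0 \<tau> ^ 2 * theta3 0 \<tau> ^ 2
              - 18 * theta2 0 (6*\<tau>) * theta3 0 (6*\<tau>)
                * (theta2 0 (6*\<tau>) ^ 2 + theta3 0 (6*\<tau>) ^ 2))))
    \<and> meromorphic_identity_on upper_half_plane
      (\<lambda>\<tau>. beta 1 \<tau> * beta 3 \<tau> * beta 5 \<tau>)
      (\<lambda>\<tau>. theta2 0 (6*\<tau>) / theta3 0 (6*\<tau>))"
  using eventually_symmetric_functions unfolding eventually_conj_iff
  by (elim conjE, intro conjI meromorphic_identity_from_cusp)
     (assumption | intro meromorphic_intros meromorphic_beta meromorphic_theta_zero)+

end
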